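(* Let $e,m$ be positive integers such that the following two properties hold. (P1) For each integer $1\le j\le e$ there is no positive integer divisor $m_1$ of $m$ such that $m_1<m$ and $(2^m-1)\mid(2j-1)(2^{m_1}-1)$. (P2) $\displaystyle\sum_{i=0}^{e+1}\binom{2^m-1}{i}>2^{me}$. Put $n=2^m-1$. Let $\theta$ be a primitive element of $\mathbb F_{2^m}$ (of multiplicative order $2^m-1$), for $1\le j\le e$ let $g_j(x)\in\mathbb F_2[x]$ be the minimal polynomial of $\theta^{2j-1}$ over $\mathbb F_2$, and let $g(x)=g_1(x)g_2(x)\cdots g_e(x)$. Let $\mathcal C\subseteq\mathbb F_2^n$ be the cyclic code of length $n$ with generator polynomial $g(x)$, and let $\mathcal O\subseteq\mathbb F_2^n$ be the Euclidean dual of $\mathcal C$. Then $\mathcal O$ is a binary orthogonal array of cardinality $M=2^{me}$ and strength $\tau=2e$, and its covering radius satisfies $$R(\mathcal O)\ge 2^{m-1}-1-(e-1)2^{m/2}.$$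
   Context: A code $C\subset\mathbb F_2^n$ with $M=|C|$ is a binary orthogonal array of strength $\tau$ if in the $M\times n$ matrix whose rows are the codewords, every $M\times\tau$ submatrix contains every element of $\mathbb F_2^\tau$ as a row exactly $M/2^\tau$ times. For linear $C$ the strength is $\tau=d^\perp-1$, where $d^\perp$ is the minimum distance of the dual code $C^\perp$. The covering radius is $R(C)=\max_{y\in\mathbb F_2^n}\min_{x\in C}d(x,y)$, with $d$ the Hamming distance. The cyclic code of length $n$ with generator polynomial $g$ is the set of coefficient vectors of the polynomials of degree less than $n$ over $\mathbb F_2$ that are multiples of $g$ (modulo $x^n-1$). The Euclidean dual is with respect to the standard inner product on $\mathbb F_2^n$. *)

theory Defs
  imports
    Complex_Main
    "HOL-Library.Cardinality"
    "HOL-Library.Z2"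
    "HOL-Computational_Algebra.Polynomial"
    "HOL-Number_Theory.Cong"
    "Jordan_Normal_Form.Matrix"
begin

text \<open>
  The field of two elements is \<^typ>\<open>bit\<close>, and the space of binary words of length \<open>n\<close> is
  \<^term>\<open>carrier_vec n :: bit vec set\<close>, with coordinates indexed by \<^term>\<open>{0..<n}\<close>.
\<close>

subsection \<open>Codes\<close>

definition hamming_dist :: "bit vec \<Rightarrow> bit vec \<Rightarrow> nat" where
  "hamming_dist x y = card {i. i < dim_vec x \<and> x $ i \<noteq> y $ i}"

definition covering_radius :: "nat \<Rightarrow> bit vec set \<Rightarrow> nat" where
  "covering_radius n C = Max ((\<lambda>y. Min ((\<lambda>x. hamming_dist x y) ` C)) ` carrier_vec n)"

definition dual_code :: "nat \<Rightarrow> bit vec set \<Rightarrow> bit vec set" where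
  "dual_code n C = {v \<in> carrier_vec n. \<forall>c\<in>C. c \<bullet> v = 0}"

text \<open>
  A choice of \<open>\<tau>\<close> columns is a set \<open>T\<close> of \<open>\<tau>\<close> coordinates; a binary word of length \<open>\<tau>\<close> is given by the
  values of \<open>a\<close> on \<open>T\<close>.
\<close>

definition orthogonal_array :: "nat \<Rightarrow> nat \<Rightarrow> bit vec set \<Rightarrow> bool" where
  "orthogonal_array n \<tau> C \<longleftrightarrow>
     C \<subseteq> carrier_vec n \<and> \<tau> \<le> n \<and>
     (\<forall>T a. T \<subseteq> {0..<n} \<and> card T = \<tau> \<longrightarrow>
        real (card {c \<in> C. \<forall>i\<in>T. c $ i = a i}) = real (card C) / 2 ^ \<tau>)"

text \<open>
  An orthogonal array of strength \<open>\<tau>\<close> also has every smaller strength; \<^emph>\<open>the\<close> strength is the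
  largest one, which for a linear code is the dual distance minus one.
\<close>

definition strength :: "nat \<Rightarrow> bit vec set \<Rightarrow> nat" where
  "strength n C = Max {\<tau>. orthogonal_array n \<tau> C}"

definition cyclic_code :: "nat \<Rightarrow> bit poly \<Rightarrow> bit vec set" where
  "cyclic_code n g =
     {vec n (coeff p) | p. degree p < n \<and> (\<exists>q. [p = q * g] (mod (monom 1 n - 1)))}"


subsection \<open>Finite extensions of the field of two elements\<close>

definition primitive_element :: "'a::{field,finite} \<Rightarrow> bool" where
  "primitive_element \<theta> \<longleftrightarrow>
     \<theta> ^ (CARD('a) - 1) = 1 \<and> (\<forall>k. 0 < k \<and> k < CARD('a) - 1 \<longrightarrow> \<theta> ^ k \<noteq> 1)"

text \<open>
  In characteristic two, \<^const>\<open>of_bit\<close> is the embedding of the prime field.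
\<close>

abbreviation has_root :: "bit poly \<Rightarrow> 'a::field \<Rightarrow> bool" where
  "has_root p \<alpha> \<equiv> poly (map_poly of_bit p) \<alpha> = 0"

definition is_minimal_poly :: "bit poly \<Rightarrow> 'a::field \<Rightarrow> bool" where
  "is_minimal_poly p \<alpha> \<longleftrightarrow>
     lead_coeff p = 1 \<and> has_root p \<alpha> \<and>
     (\<forall>q. q \<noteq> 0 \<and> has_root q \<alpha> \<longrightarrow> degree p \<le> degree q)"

definition minimal_poly :: "'a::field \<Rightarrow> bit poly" where
  "minimal_poly \<alpha> = (THE p. is_minimal_poly p \<alpha>)"

lemma of_bit_diff:
  assumes "(2::'a::field) = 0"
  shows "(of_bit (a - b) :: 'a) = of_bit a - of_bit b"
proof -
  have "(1::'a) + 1 = 0"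
    using assms by simp
  then have "(0::'a) - 1 = 1"
    by (metis add_diff_cancel_right')
  then show ?thesis
    by (cases a; cases b) auto
qed

lemma has_root_diff:
  assumes "(2::'a::field) = 0" and "has_root p \<alpha>" and "has_root q (\<alpha>::'a)"
  shows "has_root (p - q) \<alpha>"
proof -
  have "map_poly of_bit (p - q) = (map_poly of_bit p - map_poly of_bit q :: 'a poly)"
    by (rule poly_eqI) (simp only: coeff_map_poly coeff_diff of_bit_diff[OF assms(1)] even_zero not_True_eq_False of_bool_eq)
  then show ?thesis
    using assms(2,3) by simp
qed

lemma ex1_minimal_poly:
  fixes \<alpha> :: "'a::{field,finite}"
  assumes two: "(2::'a) = 0"
  shows "\<exists>!p. is_minimal_poly p \<alpha>"
proof -
  have "\<not> inj (\<lambda>i::nat. \<alpha> ^ i)"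
    using finite_imageD[of "\<lambda>i::nat. \<alpha> ^ i" UNIV] by auto
  then obtain i j :: nat where ij: "i \<noteq> j" "\<alpha> ^ i = \<alpha> ^ j"
    by (auto simp: inj_def)
  define f where "f = (monom 1 i - monom 1 j :: bit poly)"
  have mon: "map_poly of_bit (monom (1::bit) k) = (monom 1 k :: 'a poly)" for k
    by (simp add: map_poly_monom)
  have "map_poly of_bit f = (monom 1 i - monom 1 j :: 'a poly)"
    unfolding f_def mon[symmetric]
    by (rule poly_eqI) (simp only: coeff_map_poly coeff_diff of_bit_diff[OF two] even_zero not_True_eq_False of_bool_eq)
  then have f_root: "has_root f \<alpha>"
    using ij by (simp add: poly_monom)
  have "coeff f i \<noteq> 0"
    using ij(1) by (simp add: f_def coeff_monom)
  then have f0: "f \<noteq> 0"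
    by (metis coeff_0)
  define P where "P q \<longleftrightarrow> q \<noteq> 0 \<and> has_root q \<alpha>" for q
  obtain p where p: "P p" "\<And>q. P q \<Longrightarrow> degree p \<le> degree q"
    using ex_has_least_nat[of P f degree] f0 f_root unfolding P_def by blast
  have monic: "lead_coeff q = 1" if "q \<noteq> 0" for q :: "bit poly"
    using that leading_coeff_neq_0 bit_not_zero_iff by blast
  have "is_minimal_poly p \<alpha>"
    using p monic unfolding is_minimal_poly_def P_def by blast
  moreover have "q = p" if q: "is_minimal_poly q \<alpha>" for q
  proof (rule ccontr)
    assume "q \<noteq> p"
    then have ne: "q - p \<noteq> 0"
      by (metis right_minus_eq)
    have q0: "q \<noteq> 0"
      using q by (auto simp: is_minimal_poly_def)
    have "has_root q \<alpha>" "has_root p \<alpha>"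
      using q p by (auto simp: is_minimal_poly_def P_def)
    then have root: "has_root (q - p) \<alpha>"
      by (rule has_root_diff[OF two])
    have deg: "degree q = degree p"
      using q p q0 by (intro antisym) (auto simp: is_minimal_poly_def P_def)
    have le: "degree (q - p) \<le> degree p"
      using degree_diff_le_max[of q p] deg by (simp del: minus_bit_def)
    have "degree p \<le> degree (q - p)"
      using ne root p(2) unfolding P_def by blast
    then have eq: "degree (q - p) = degree p"
      using le by simp
    have "coeff (q - p) (degree p) = lead_coeff q - lead_coeff p"
      using deg by (simp only: coeff_diff)
    also have "\<dots> = 0"
      using monic[OF q0] monic[of p] p by (simp add: P_def)
    finally show False
      using eq ne by (metis leading_coeff_0_iff)
  qed
  ultimately show ?thesis
    by blast
qed

end

theory Submission
  imports Defs "HOL-Computational_Algebra.Computational_Algebra" "HOL-Algebra.Algebraic_Closure_Type"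
begin

text \<open>
  Reading the coordinates as nonzero field elements \<open>x\<close>, the dual code consists of the words
  \<open>Tr (f x)\<close> with \<open>f = \<Sum>j=1..e. a j * x ^ (2 * j - 1)\<close>. These words are distinct because the conjugates of
  the \<open>\<theta> ^ (2 * j - 1)\<close> are: (P1) gives each of them \<open>m\<close> conjugates, and if two were conjugate to each
  other, the Hamming bound would contradict (P2). There are no further words, because a word of the dual
  satisfies a linear recurrence of order at most \<open>m * e\<close> given by the generator polynomial.

  Any \<open>2 * e\<close> coordinates are independent by the BCH bound. By (P2) two sets of at most \<open>e + 1\<close> coordinates
  have the same syndrome, and translating their symmetric difference so that it contains 0 makes at most
  \<open>2 * e + 1\<close> coordinates dependent.

  The distance of the word of \<open>f\<close> to the all-one word is the number of \<open>x \<noteq> 0\<close> with \<open>Tr (f x) = 0\<close>, so the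
  covering radius follows from the Weil bound for \<open>\<Sum>x. (-1) ^ Tr (f x)\<close>. Summing characters over monic
  polynomials expresses the character sums over all extension fields as power sums of \<open>degree f - 1\<close> complex
  numbers; Stepanov's method bounds the sums over large extensions of even degree up to a constant factor,
  and this already forces the complex numbers to have modulus at most \<open>2 powr (m / 2)\<close>.
\<close>

hide_const (open) Divisibility.prime up_ring.coeff up_ring.monom Coset.order
  Polynomials.degree Polynomials.lead_coeff module.smult

section \<open>Frobenius powers and the absolute trace in characteristic two\<close>

text \<open>The Weil bound needs the fields of 2^(m*k) elements for all k together, so they are
  realised inside one algebraically closed field as fixed sets of Frobenius powers; the given finite
  field is embedded only afterwards. Even degree is what makes Stepanov's method elementary here:
  the field then has q^2 elements with q = 2^h, so raising to the power q is an involution on it,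
  and on the curve y^2 + y = f x it takes y to y + T x for an explicit polynomial T. A lossy
  constant is harmless, because the sum over degree m*k is a power sum of exponent k of fixed
  complex numbers, and growth in k sees only their largest modulus. No degree of a minimal
  polynomial is ever computed exactly: only the upper bound m*e for the generator is proved, and the
  2^(m*e) distinct trace words close the gap. For their distinctness (P2) has to be played against
  sets of at most e points, although it speaks of e + 1; passing from one range to the other costs a
  factor 2^m, precisely one component of the syndrome.\<close>

lemma prod_mset_linear_ne_0: "(\<Prod>x\<in>#A. [:-x, 1:] :: 'a::idom poly) \<noteq> 0"
  by (induction A) (auto simp del: mult_pCons_left)

lemma proots_prod_mset_linear: "proots (\<Prod>x\<in>#A. [:-x, 1:] :: 'a::idom poly) = A"
proof (induction A)
  case (add a A)
  have "proots (\<Prod>x\<in>#add_mset a A. [:-x, 1:]) = proots [:-a, 1:] + proots (\<Prod>x\<in>#A. [:-x, 1:])"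
    using prod_mset_linear_ne_0[of "add_mset a A"] by (simp add: proots_mult del: mult_pCons_left)
  then show ?case
    by (simp add: add del: mult_pCons_left)
qed simp

lemma poly_eq_prod_mset_proots:
  fixes p :: "'a::alg_closed_field poly" assumes "lead_coeff p = 1"
  shows "p = (\<Prod>x\<in>#proots p. [:-x, 1:])" "size (proots p) = degree p"
proof -
  have "p \<noteq> 0" using assms by auto
  then obtain A where A: "size A = degree p" "p = smult (lead_coeff p) (\<Prod>x\<in>#A. [:-x, 1:])"
    using alg_closed_imp_factorization by blast
  then have "p = (\<Prod>x\<in>#A. [:-x, 1:])" using assms by simp
  moreover from this have "proots p = A" by (simp add: proots_prod_mset_linear)
  ultimately show "p = (\<Prod>x\<in>#proots p. [:-x, 1:])" "size (proots p) = degree p"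
    using A(1) by simp_all
qed

locale char2 =
  fixes K :: "'k::field itself"
  assumes char2: "CHAR('k) = 2"
begin

lemma frob_add: "((x::'k) + y) ^ 2 ^ N = x ^ 2 ^ N + y ^ 2 ^ N"
  using freshmans_dream'[of "2 ^ N" N x y] by (simp add: char2)

lemma frob_sum: "(\<Sum>i\<in>A. f i :: 'k) ^ 2 ^ N = (\<Sum>i\<in>A. f i ^ 2 ^ N)"
  using freshmans_dream_sum'[of "2 ^ N" N f A] by (simp add: char2)

lemma add_self [simp]: "(x::'k) + x = 0"
  by (metis char2 uminus_CHAR_2 add.right_inverse)

lemma add_self_left [simp]: "(x::'k) + (x + y) = y"
  by (simp flip: add.assoc)

lemma minus_eq_add: "(x::'k) - y = x + y"
  using minus_CHAR_2[OF char2] .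

lemma two_eq_zero: "(2::'k) = 0"
  by (metis add_self one_add_one)

lemma add_eq_zero_iff: "(x::'k) + y = 0 \<longleftrightarrow> x = y"
  by (metis add_self add_self_left add_0_right)

lemma frob_eq_zero_iff [simp]: "(x::'k) ^ 2 ^ N = 0 \<longleftrightarrow> x = 0"
  by simp

lemma frob_inj: "(x::'k) ^ 2 ^ N = y ^ 2 ^ N \<longleftrightarrow> x = y"
  by (metis add_eq_zero_iff frob_add frob_eq_zero_iff)

text \<open>For N > 0 these are the roots of X^(2^N) - X, hence the subfield with 2^N elements once
  the ambient field is algebraically closed.\<close>

definition frob_fix :: "nat \<Rightarrow> 'k set" where
  "frob_fix N = {x. x ^ 2 ^ N = x}"

lemma frob_fixD: "x \<in> frob_fix N \<Longrightarrow> x ^ 2 ^ N = x"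
  by (simp add: frob_fix_def)

lemma frob_fix_0 [simp]: "0 \<in> frob_fix N" and frob_fix_1 [simp]: "1 \<in> frob_fix N"
  by (simp_all add: frob_fix_def)

lemma frob_fix_add: "x \<in> frob_fix N \<Longrightarrow> y \<in> frob_fix N \<Longrightarrow> x + y \<in> frob_fix N"
  by (simp add: frob_fix_def frob_add)

lemma frob_fix_mult: "x \<in> frob_fix N \<Longrightarrow> y \<in> frob_fix N \<Longrightarrow> x * y \<in> frob_fix N"
  by (simp add: frob_fix_def power_mult_distrib)

lemma frob_fix_divide: "x \<in> frob_fix N \<Longrightarrow> y \<in> frob_fix N \<Longrightarrow> x / y \<in> frob_fix N"
  by (simp add: frob_fix_def power_divide)

lemma frob_fix_power: "x \<in> frob_fix N \<Longrightarrow> x ^ k \<in> frob_fix N"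
  by (induction k) (simp_all add: frob_fix_mult)

lemma frob_fix_sum: "(\<And>i. i \<in> A \<Longrightarrow> f i \<in> frob_fix N) \<Longrightarrow> (\<Sum>i\<in>A. f i) \<in> frob_fix N"
  by (simp add: frob_fix_def frob_sum)

lemma frob_fix_poly:
  assumes "\<And>i. coeff p i \<in> frob_fix N" "x \<in> frob_fix N"
  shows "poly p x \<in> frob_fix N"
  unfolding poly_altdef using assms by (intro frob_fix_sum frob_fix_mult frob_fix_power)

lemma frob_iter: "(x::'k) ^ 2 ^ (m * k) = ((\<lambda>x. x ^ 2 ^ m) ^^ k) x"
proof (induction k)
  case (Suc k)
  have "x ^ 2 ^ (m * Suc k) = (x ^ 2 ^ (m * k)) ^ 2 ^ m"
    by (simp add: power_add mult.commute flip: power_mult)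
  then show ?case
    by (simp add: Suc)
qed simp

lemma frob_fix_dvd:
  assumes "x \<in> frob_fix m" shows "x \<in> frob_fix (m * k)"
proof -
  have "((\<lambda>x. x ^ 2 ^ m) ^^ k) x = x"
    using assms by (induction k) (simp_all add: frob_fix_def)
  then show ?thesis
    by (simp add: frob_fix_def frob_iter)
qed

lemma frob_poly:
  assumes "\<And>i. coeff p i \<in> frob_fix m"
  shows "poly p (x ^ 2 ^ (m * k)) = poly p x ^ 2 ^ (m * k)"
proof -
  have "coeff p i ^ 2 ^ (m * k) = coeff p i" for i
    using frob_fix_dvd[OF assms] frob_fixD by blast
  then show ?thesis
    unfolding poly_altdef frob_sum
    by (intro sum.cong) (simp_all add: power_mult_distrib mult.commute flip: power_mult)
qed

lemma finite_frob_fix: assumes "N > 0" shows "finite (frob_fix N)" "card (frob_fix N) \<le> 2 ^ N"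
proof -
  define p where "p = (monom 1 (2 ^ N) - monom 1 1 :: 'k poly)"
  have *: "(1::nat) < 2 ^ N"
    using assms by (metis assms one_less_numeral_iff one_less_power semiring_norm(76))
  have "coeff p (2 ^ N) = 1"
    using * by (simp add: p_def coeff_monom)
  then have p0: "p \<noteq> 0"
    by (metis coeff_0 zero_neq_one)
  have eq: "frob_fix N = {x. poly p x = 0}"
    by (auto simp: frob_fix_def p_def poly_monom)
  have "degree p \<le> 2 ^ N"
    unfolding p_def by (rule degree_diff_le) (use * in \<open>auto intro: order.trans[OF degree_monom_le]\<close>)
  with eq p0 show "finite (frob_fix N)" "card (frob_fix N) \<le> 2 ^ N"
    using poly_roots_finite[OF p0] card_poly_roots_bound[OF p0] by auto
qed

text \<open>The absolute trace of the field with 2^N elements. Outside \<open>frob_fix N\<close> it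
  is merely an additive polynomial, so statements about its values being 0 or 1 need
  membership.\<close>

definition tr :: "nat \<Rightarrow> 'k \<Rightarrow> 'k" where
  "tr N z = (\<Sum>i<N. z ^ 2 ^ i)"

lemma tr_add: "tr N (x + y) = tr N x + tr N y"
  by (simp add: tr_def frob_add sum.distrib)

lemma tr_0 [simp]: "tr N 0 = 0"
  by (simp add: tr_def power_0_left)

lemma tr_sum: "tr N (\<Sum>i\<in>A. f i) = (\<Sum>i\<in>A. tr N (f i))"
  by (induction A rule: infinite_finite_induct) (simp_all add: tr_add)

text \<open>Squaring shifts the exponents by one, so everything but the two ends cancels in
  characteristic two. On \<open>frob_fix N\<close> the ends cancel as well, which is why a trace t
  satisfies t^2 + t = 0.\<close>

lemma sum_frob_square_add: "(\<Sum>i<N. (z::'k) ^ 2 ^ i) ^ 2 + (\<Sum>i<N. z ^ 2 ^ i) = z ^ 2 ^ N + z"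
proof (induction N)
  case (Suc N)
  have sq: "(a + b) ^ 2 = a ^ 2 + b ^ 2" for a b :: 'k
    using frob_add[of a b 1] by simp
  have "(\<Sum>i<Suc N. z ^ 2 ^ i)^2 + (\<Sum>i<Suc N. z ^ 2 ^ i)
     = ((\<Sum>i<N. z ^ 2 ^ i)^2 + (\<Sum>i<N. z ^ 2 ^ i)) + (z ^ 2 ^ N + (z ^ 2 ^ N)^2)"
    by (simp add: sq algebra_simps)
  also have "(z ^ 2 ^ N)^2 = z ^ 2 ^ Suc N"
    by (simp flip: power_mult add: mult.commute)
  finally show ?case
    unfolding Suc by (simp add: add_ac)
qed simp

lemma tr_cases:
  assumes "z \<in> frob_fix N" shows "tr N z = 0 \<or> tr N z = 1"
proof -
  have "(tr N z)^2 + tr N z = 0"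
    using sum_frob_square_add[where N=N and z=z] assms by (simp add: tr_def frob_fix_def)
  then have "tr N z * (tr N z + 1) = 0"
    by (simp add: power2_eq_square algebra_simps)
  then show ?thesis
    by (simp add: add_eq_zero_iff)
qed

text \<open>Telescoping again. With the full length N it yields additive Hilbert 90; with half the
  length it expresses y^(2^h) through y and z, the relation on which Stepanov's method
  rests.\<close>

lemma sum_frob_artin_schreier:
  assumes "(y::'k)^2 + y = z" shows "(\<Sum>i<h. z ^ 2 ^ i) = y ^ 2 ^ h + y"
proof -
  have "z ^ 2 ^ i = y ^ 2 ^ Suc i + y ^ 2 ^ i" for i
    using frob_add[of "y^2" y i] assms by (simp flip: power_mult)
  then have "(\<Sum>i<h. z ^ 2 ^ i) = (\<Sum>i<h. y ^ 2 ^ Suc i + y ^ 2 ^ i)"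
    by simp
  also have "\<dots> = y ^ 2 ^ h + y"
    by (induction h) (simp_all add: add_ac)
  finally show ?thesis .
qed

lemma sum_lessThan_add: "(\<Sum>i<a + b. f i) = (\<Sum>i<a. f i) + (\<Sum>i<b. f (a + i) :: 'k)" for a b :: nat
  by (induction b) (simp_all add: add.assoc)

text \<open>Transitivity of the trace: writing exponents as m*i + j, the sum over i is the relative
  trace down to the field with 2^m elements.\<close>

lemma tr_mult_degree: "tr (m * k) z = tr m (\<Sum>i<k. z ^ 2 ^ (m * i))"
proof -
  have "tr (m * k) z = (\<Sum>i<k. \<Sum>j<m. z ^ 2 ^ (m * i + j))"
    unfolding tr_def by (induction k) (simp_all add: sum_lessThan_add add.commute[of m])
  also have "\<dots> = (\<Sum>i<k. tr m (z ^ 2 ^ (m * i)))"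
    by (simp add: tr_def power_add power_mult)
  finally show ?thesis
    by (simp add: tr_sum)
qed

text \<open>The trace is a nonzero polynomial of degree at most 2^(N-1), too small to vanish on 2^N
  points. The set is arbitrary because both \<open>frob_fix N\<close> and the whole of a finite
  field are needed.\<close>

lemma ex_tr_ne_zero:
  assumes "N > 0" "finite S" "card S = 2 ^ N" shows "\<exists>c\<in>S. tr N c \<noteq> 0"
proof (rule ccontr)
  define p where "p = (\<Sum>i<N. monom 1 (2 ^ i) :: 'k poly)"
  assume "\<not> ?thesis"
  then have sub: "S \<subseteq> {x. poly p x = 0}"
    by (auto simp: p_def poly_sum poly_monom tr_def)
  have inj: "(2::nat) ^ i = 2 ^ j \<longleftrightarrow> i = j" for i j
    by simp
  have "coeff p (2 ^ (N - 1)) = (\<Sum>i<N. if i = N - 1 then 1 else 0)"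
    by (simp add: p_def coeff_sum coeff_monom inj del: power_inject_exp)
  also have "\<dots> = 1"
    using assms by (subst sum.delta) auto
  finally have p0: "p \<noteq> 0"
    by (metis coeff_0 zero_neq_one)
  have "degree p \<le> 2 ^ (N - 1)"
    unfolding p_def
    by (intro degree_sum_le) (auto intro!: order.trans[OF degree_monom_le] power_increasing)
  then have "card S \<le> 2 ^ (N - 1)"
    using card_mono[OF poly_roots_finite[OF p0] sub] card_poly_roots_bound[OF p0] by linarith
  moreover have "(2::nat) ^ N = 2 * 2 ^ (N - 1)"
    using assms(1) by (cases N) auto
  ultimately show False
    using assms(3) by simp
qed

definition psi :: "nat \<Rightarrow> 'k \<Rightarrow> int" where
  "psi N z = (if tr N z = 0 then 1 else -1)"

lemma psi_0 [simp]: "psi N 0 = 1"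
  by (simp add: psi_def)

lemma psi_add:
  assumes "x \<in> frob_fix N" "y \<in> frob_fix N" shows "psi N (x + y) = psi N x * psi N y"
  using tr_cases[OF assms(1)] tr_cases[OF assms(2)] by (auto simp: psi_def tr_add)

lemma psi_mult_degree: "psi (m * k) z = psi m (\<Sum>i<k. z ^ 2 ^ (m * i))"
  by (simp add: psi_def tr_mult_degree)

end

locale closed_char2 = char2 K for K :: "'k::alg_closed_field itself"
begin

text \<open>X^(2^N) - X has derivative -1, so all its roots are simple.\<close>

lemma card_frob_fix:
  assumes "N > 0" shows "card (frob_fix N) = 2 ^ N"
proof -
  define p where "p = (monom 1 (2 ^ N) - monom 1 1 :: 'k poly)"
  have *: "(1::nat) < 2 ^ N"
    using assms by (metis assms one_less_numeral_iff one_less_power semiring_norm(76))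
  have deg: "degree p = 2 ^ N"
    unfolding p_def diff_conv_add_uminus using *
    by (subst degree_add_eq_left) (simp_all add: degree_monom_eq)
  then have p0: "p \<noteq> 0"
    using * by (metis degree_0 not_less_zero)
  have "of_nat (2 ^ N) = (0::'k)"
    using assms by (simp add: two_eq_zero)
  then have pd: "pderiv p = - 1"
    by (simp only: p_def pderiv_diff pderiv_monom) (simp add: monom_0 one_pCons)
  have sq: "order a p \<le> 1" for a
  proof (rule ccontr)
    assume "\<not> order a p \<le> 1"
    then have "[:-a, 1:] ^ 2 dvd p"
      by (intro dvd_trans[OF le_imp_power_dvd order_1]) simp
    then obtain r where "p = [:-a, 1:] * ([:-a, 1:] * r)"
      by (metis dvdE mult.assoc power2_eq_square)
    then have "poly (pderiv p) a = 0"
      by (simp add: pderiv_mult del: mult_pCons_left)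
    then show False
      by (simp add: pd)
  qed
  have "lead_coeff p = 1"
    unfolding deg unfolding p_def using * by simp
  from poly_eq_prod_mset_proots(2)[OF this] deg have szA: "size (proots p) = 2 ^ N" by simp
  define A where "A = proots p"
  have "count A x \<le> 1" for x
    using sq[of x] p0 by (simp add: A_def)
  then have "A = mset_set (set_mset A)"
    by (intro multiset_eqI) (metis count_eq_zero_iff count_mset_set(1) count_mset_set(3) finite_set_mset le_antisym not_in_iff One_nat_def Suc_leI count_greater_zero_iff)
  then have "card (set_mset A) = size A"
    by (metis size_mset_set)
  moreover have "set_mset A = frob_fix N"
    using p0 by (auto simp: A_def frob_fix_def p_def poly_monom)
  ultimately show ?thesis
    using szA by (simp add: A_def)
qed

text \<open>Additive Hilbert 90: algebraic closedness provides some y with y^2 + y = z, and the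
  telescoped trace y^(2^N) + y vanishes exactly when y lies in \<open>frob_fix N\<close>. This turns
  character sums into point counts.\<close>

lemma psi_eq_artin_schreier:
  assumes "z \<in> frob_fix N"
  shows "psi N z = (if \<exists>y\<in>frob_fix N. y^2 + y = z then 1 else -1)"
proof -
  define F :: "nat \<Rightarrow> 'k" where "F = (\<lambda>i. if i = 0 then - z else 1)"
  have "\<exists>y. (\<Sum>k\<le>2. F k * y ^ k) = 0"
    by (rule alg_closed) (auto simp: F_def)
  then obtain y where "(\<Sum>k\<le>2. F k * y ^ k) = 0" ..
  then have "(y^2 + y) + z = 0"
    by (simp add: F_def numeral_2_eq_2 minus_eq_add add_ac)
  then have y: "y^2 + y = z"
    by (simp only: add_eq_zero_iff)
  have "tr N z = y' ^ 2 ^ N + y'" if "y'^2 + y' = z" for y'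
    using sum_frob_artin_schreier[OF that] by (simp add: tr_def)
  then show ?thesis
    using y unfolding psi_def frob_fix_def mem_Collect_eq Bex_def by (metis add_eq_zero_iff)
qed

text \<open>Translating u by some b for which a*b has trace 1 reverses the sign of every
  term.\<close>

lemma sum_psi_mult_eq_0:
  assumes "N > 0" "a \<in> frob_fix N" "a \<noteq> 0"
  shows "(\<Sum>u\<in>frob_fix N. psi N (a * u)) = 0"
proof -
  obtain c where c: "c \<in> frob_fix N" "tr N c \<noteq> 0"
    using ex_tr_ne_zero[OF assms(1) finite_frob_fix(1) card_frob_fix] assms(1) by blast
  define b where "b = c / a"
  have b: "b \<in> frob_fix N" "a * b = c"
    using assms c by (auto simp: b_def intro: frob_fix_divide)
  have "(\<Sum>u\<in>frob_fix N. psi N (a * u)) = (\<Sum>u\<in>frob_fix N. psi N (a * (u + b)))"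
    by (rule sum.reindex_bij_witness[of _ "\<lambda>u. u + b" "\<lambda>u. u + b"]) (auto intro: frob_fix_add b simp: add.assoc)
  also have "\<dots> = (\<Sum>u\<in>frob_fix N. - psi N (a * u))"
  proof (intro sum.cong refl)
    fix u assume "u \<in> frob_fix N"
    then have "psi N (a * u + c) = psi N (a * u) * psi N c"
      using assms c by (intro psi_add frob_fix_mult)
    then show "psi N (a * (u + b)) = - psi N (a * u)"
      using c by (simp add: distrib_left b) (simp add: psi_def)
  qed
  finally show ?thesis
    by (simp add: sum_negf)
qed

end
section \<open>Stepanov's method for Artin--Schreier curves\<close>

text \<open>Gaussian elimination: a pivot \<open>i0\<close> removes one equation and one unknown,
  and its own coefficient is restored afterwards. It supplies the auxiliary function in Stepanov's
  method.\<close>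

lemma ex_nontrivial_relation:
  fixes v :: "'i \<Rightarrow> nat \<Rightarrow> 'a::field"
  assumes "finite I" "n < card I"
  shows "\<exists>c. (\<exists>i\<in>I. c i \<noteq> 0) \<and> (\<forall>k<n. (\<Sum>i\<in>I. c i * v i k) = 0)"
  using assms
proof (induction n arbitrary: I v)
  case 0
  then have "I \<noteq> {}" by auto
  then show ?case by (intro exI[of _ "\<lambda>_. 1"]) auto
next
  case (Suc n)
  show ?case
  proof (cases "\<forall>i\<in>I. v i n = 0")
    case True
    obtain c where c: "\<exists>i\<in>I. c i \<noteq> 0" "\<forall>k<n. (\<Sum>i\<in>I. c i * v i k) = 0"
      using Suc.IH[of I v] Suc.prems by (metis Suc_lessD)
    then show ?thesis
      using True by (intro exI[of _ c]) (auto simp: less_Suc_eq)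
  next
    case False
    then obtain i0 where i0: "i0 \<in> I" "v i0 n \<noteq> 0" by blast
    define w where "w i k = v i k - v i n / v i0 n * v i0 k" for i k
    have n: "finite (I - {i0})" "n < card (I - {i0})"
      using Suc.prems i0 by auto
    obtain c where c: "\<exists>i\<in>I - {i0}. c i \<noteq> 0" "\<And>k. k < n \<Longrightarrow> (\<Sum>i\<in>I - {i0}. c i * w i k) = 0"
      using Suc.IH[of "I - {i0}" w] n by blast
    have wn: "(\<Sum>i\<in>I - {i0}. c i * w i n) = 0"
      using i0 by (simp add: w_def)
    define c' where "c' i = (if i = i0 then - (\<Sum>i\<in>I - {i0}. c i * (v i n / v i0 n)) else c i)" for i
    have "(\<Sum>i\<in>I. c' i * v i k) = (\<Sum>i\<in>I - {i0}. c i * w i k)" for k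
    proof -
      have "(\<Sum>i\<in>I. c' i * v i k) = c' i0 * v i0 k + (\<Sum>i\<in>I - {i0}. c' i * v i k)"
        using Suc.prems i0 by (simp add: sum.remove)
      also have "(\<Sum>i\<in>I - {i0}. c' i * v i k) = (\<Sum>i\<in>I - {i0}. c i * v i k)"
        by (intro sum.cong) (auto simp: c'_def)
      also have "c' i0 * v i0 k = (\<Sum>i\<in>I - {i0}. - (c i * (v i n / v i0 n) * v i0 k))"
        by (simp add: c'_def sum_distrib_right sum_negf)
      finally show ?thesis
        by (simp add: w_def algebra_simps flip: sum.distrib)
    qed
    moreover have "\<exists>i\<in>I. c' i \<noteq> 0"
      using c(1) by (auto simp: c'_def)
    ultimately show ?thesis
      using c(2) wn by (intro exI[of _ c']) (auto simp: less_Suc_eq)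
  qed
qed

lemma sum_distinct_degrees_ne_0:
  fixes p :: "'i \<Rightarrow> 'a::comm_ring_1 poly"
  assumes "finite I" "I \<noteq> {}" "\<And>i. i \<in> I \<Longrightarrow> p i \<noteq> 0" "inj_on (\<lambda>i. degree (p i)) I"
  shows "(\<Sum>i\<in>I. p i) \<noteq> 0"
proof -
  have "Max ((\<lambda>i. degree (p i)) ` I) \<in> (\<lambda>i. degree (p i)) ` I"
    using assms by (intro Max_in) auto
  then obtain i0 where i0: "i0 \<in> I" "degree (p i0) = Max ((\<lambda>i. degree (p i)) ` I)" by auto
  have "degree (p i) < degree (p i0)" if "i \<in> I - {i0}" for i
  proof -
    have "degree (p i) \<le> degree (p i0)"
      using that assms(1) i0(2) by simp
    moreover have "degree (p i) \<noteq> degree (p i0)"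
      using that i0(1) assms(4) by (auto simp: inj_on_def)
    ultimately show ?thesis by simp
  qed
  then have "coeff (\<Sum>i\<in>I. p i) (degree (p i0)) = lead_coeff (p i0)"
    using assms(1) i0(1) by (simp add: coeff_sum sum.remove coeff_eq_0)
  then show ?thesis
    using assms(3)[OF i0(1)] by (metis coeff_0 leading_coeff_neq_0)
qed

lemma degree_sum_powers_two:
  fixes f :: "'a::idom poly"
  assumes "degree f > 0"
  shows "degree (\<Sum>i<Suc k. f ^ 2 ^ i) = degree f * 2 ^ k"
proof (induction k)
  case (Suc k)
  have deg: "degree (f ^ 2 ^ Suc k) = degree f * 2 ^ Suc k"
    using assms by (subst degree_power_eq) auto
  have "degree (\<Sum>i<Suc k. f ^ 2 ^ i) < degree (f ^ 2 ^ Suc k)"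
    unfolding deg Suc using assms by simp
  then show ?case
    unfolding sum.lessThan_Suc[of _ "Suc k"] by (subst degree_add_eq_right) (simp_all only: deg)
qed simp

context closed_char2
begin

text \<open>A function A + B*y that is not zero is combined from the monomials x^j * (x^q)^a * y^e *
  (y^q)^u so that its q-th power, rewritten with (x^q)^q = x and (y^q)^q = y, is identically zero.
  It therefore vanishes at all points over the field. Above each x in question lie both y and y + 1,
  so A and B vanish there separately, and the degree of whichever is nonzero bounds the number of
  such x.\<close>

theorem card_artin_schreier_le:
  fixes f :: "'k poly"
  assumes deg: "degree f = 2 * g + 1" and h: "h > 0" and large: "(2 * g + 1) * (g + 1) < 2 ^ h"
  shows "2 * card {x \<in> frob_fix (2 * h). \<exists>y\<in>frob_fix (2 * h). y^2 + y = poly f x}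
           \<le> 2 ^ (2 * h) + 2 * degree f * 2 ^ h"
proof -
  define d where "d = degree f"
  define p where "p = (2::nat) ^ (h - 1)"
  define q where "q = (2::nat) ^ h"
  have qp: "q = 2 * p"
    using h by (cases h) (auto simp: p_def q_def)
  have Q: "2 ^ (2 * h) = q * q"
    by (simp add: q_def power2_eq_square mult.commute power_mult)
  have d: "d = 2 * g + 1" by (simp add: d_def deg)
  have gp: "g < p"
  proof -
    have "2 * g + 1 \<le> (2 * g + 1) * (g + 1)" by simp
    then show ?thesis using large qp by (simp add: q_def)
  qed
  \<comment> \<open>The range j < s keeps 2*j + d below q, which will separate the weights of the
    monomials. The range a < M is then wide enough for the 4*M*s unknowns to outnumber the 2*L
    equations, and that inequality is equivalent to \<open>large\<close>.\<close>
  define s where "s = p - g"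
  define M where "M = p + g + 1"
  define T where "T = (\<Sum>i<h. f ^ 2 ^ i)"
  have degT: "degree T = d * p"
    using degree_sum_powers_two[of f "h - 1"] h deg by (simp add: T_def p_def d_def)
  text \<open>On a point of the curve \<open>y^2 + y = f x\<close> one has \<open>y ^ q = y + T x\<close>, and \<open>PA e u + PB e u * y\<close>
    is the expansion of \<open>y ^ e * (y ^ q) ^ u\<close> (for \<open>e, u\<close> in 0, 1) in the basis \<open>1, y\<close>.\<close>
  define PA :: "bool \<Rightarrow> bool \<Rightarrow> 'k poly" where
    "PA e u = (if u then (if e then f else T) else (if e then 0 else 1))" for e u
  define PB :: "bool \<Rightarrow> bool \<Rightarrow> 'k poly" where
    "PB e u = (if u then (if e then 1 + T else 1) else (if e then 1 else 0))" for e u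
  have dp: "d \<le> d * p"
    using gp by simp
  have degP: "degree (PA e u) \<le> d * p" "degree (PB e u) \<le> d * p" for e u
    using dp degT by (auto simp: PA_def PB_def d_def intro: degree_add_le)
  define I where "I = {..<M} \<times> {..<s} \<times> (UNIV :: bool set) \<times> (UNIV :: bool set)"
  have finI: "finite I" by (simp add: I_def)
  have cardI: "card I = 4 * (M * s)" by (simp add: I_def card_cartesian_product)
  \<comment> \<open>\<open>HA + HB * y\<close> is the monomial itself and \<open>RA + RB * y\<close>
    its q-th power. The latter is x^(j*q + a) * y^u * (y^q)^e at a point of the curve over the
    field: the roles of e and u are exchanged, hence \<open>PA u e\<close>.\<close>
  define RA where "RA = (\<lambda>(a, j, e, u). monom 1 (j * q + a) * PA u e)"
  define RB where "RB = (\<lambda>(a, j, e, u). monom 1 (j * q + a) * PB u e)"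
  define HA where "HA = (\<lambda>(a, j, e, u). monom 1 (j + a * q) * PA e u)"
  define HB where "HB = (\<lambda>(a, j, e, u). monom 1 (j + a * q) * PB e u)"
  define L where "L = 2 * p * p + g + 1"
  have ps: "p = s + g" using gp by (simp add: s_def)
  have degR: "degree (RA i) < L" "degree (RB i) < L" if "i \<in> I" for i
  proof -
    obtain a j e u where i: "i = (a, j, e, u)" by (cases i)
    then have aj: "a < M" "j < s" using that by (auto simp: I_def)
    have "j * q \<le> (s - 1) * q" using aj by (intro mult_right_mono) auto
    then have "j * q + a + d * p < (s - 1) * q + M + d * p" using aj by linarith
    also have "\<dots> \<le> L"
      using aj unfolding L_def M_def d qp ps by (cases s) (auto simp: algebra_simps)
    finally have *: "j * q + a + d * p < L" .
    show "degree (RA i) < L" "degree (RB i) < L"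
      unfolding i RA_def RB_def prod.case
      by (rule le_less_trans[OF degree_mult_le le_less_trans[OF add_mono[OF degree_monom_le degP(1)] *]])
         (rule le_less_trans[OF degree_mult_le le_less_trans[OF add_mono[OF degree_monom_le degP(2)] *]])
  qed
  have "2 * L < card I"
  proof -
    have "(2 * g + 1) * (g + 1) < 2 * (s + g)" using large qp ps by (simp add: q_def)
    then show ?thesis unfolding cardI L_def M_def ps by (simp add: algebra_simps)
  qed
  then obtain c where c: "\<exists>i\<in>I. c i \<noteq> 0"
    "\<And>k. k < 2 * L \<Longrightarrow> (\<Sum>i\<in>I. c i * (if k < L then coeff (RA i) k else coeff (RB i) (k - L))) = 0"
    using ex_nontrivial_relation[OF finI, of "2 * L" "\<lambda>i k. if k < L then coeff (RA i) k else coeff (RB i) (k - L)"]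
    by blast
  have RA0: "(\<Sum>i\<in>I. smult (c i) (RA i)) = 0"
  proof (rule poly_eqI)
    fix k show "coeff (\<Sum>i\<in>I. smult (c i) (RA i)) k = coeff 0 k"
    proof (cases "k < L")
      case True
      then show ?thesis using c(2)[of k] by (simp add: coeff_sum)
    next
      case False
      then have "coeff (RA i) k = 0" if "i \<in> I" for i using degR(1)[OF that] by (intro coeff_eq_0) simp
      then show ?thesis by (simp add: coeff_sum)
    qed
  qed
  have RB0: "(\<Sum>i\<in>I. smult (c i) (RB i)) = 0"
  proof (rule poly_eqI)
    fix k show "coeff (\<Sum>i\<in>I. smult (c i) (RB i)) k = coeff 0 k"
    proof (cases "k < L")
      case True
      then show ?thesis using c(2)[of "k + L"] by (simp add: coeff_sum)
    next
      case False
      then have "coeff (RB i) k = 0" if "i \<in> I" for i using degR(2)[OF that] by (intro coeff_eq_0) simp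
      then show ?thesis by (simp add: coeff_sum)
    qed
  qed
  \<comment> \<open>The linear system determines the coefficients of the q-th power; those of the
    function itself are their q-th roots.\<close>
  have "\<exists>y. y ^ q = c i" for i
    by (rule nth_root_exists) (simp add: q_def)
  then obtain b where b: "\<And>i. b i ^ q = c i" by metis
  define A where "A = (\<Sum>i\<in>I. smult (b i) (HA i))"
  define B where "B = (\<Sum>i\<in>I. smult (b i) (HB i))"
  define S where "S = {x \<in> frob_fix (2 * h). \<exists>y\<in>frob_fix (2 * h). y^2 + y = poly f x}"
  have van: "poly A x = 0 \<and> poly B x = 0" if "x \<in> S" for x
  proof -
    have *: "poly A x + poly B x * y = 0" if y: "y \<in> frob_fix (2 * h)" "y^2 + y = poly f x" for y
    proof -
      have xq: "(x ^ q) ^ q = x" and yq: "(y ^ q) ^ q = y"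
        using \<open>x \<in> S\<close> y by (simp_all add: S_def frob_fix_def Q flip: power_mult)
      have "poly T x = (\<Sum>i<h. (poly f x) ^ 2 ^ i)" by (simp add: T_def poly_sum)
      also have "\<dots> = y ^ q + y"
        using sum_frob_artin_schreier[OF y(2)] by (simp add: q_def)
      finally have T: "poly T x = y ^ q + y" .
      have f: "poly f x = y * y + y" using y(2) by (simp add: power2_eq_square)
      have P: "poly (PA e u) x + poly (PB e u) x * y = (if e then y else 1) * (if u then y ^ q else 1)" for e u
        by (auto simp: PA_def PB_def T f algebra_simps)
      have frq: "(r + t) ^ q = r ^ q + t ^ q" "(\<Sum>i\<in>J. r' i) ^ q = (\<Sum>i\<in>J. r' i ^ q)" for r t :: 'k and r' :: "nat \<times> nat \<times> bool \<times> bool \<Rightarrow> 'k" and J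
        by (simp_all only: q_def frob_add frob_sum)
      have term_eq: "(poly (HA i) x + poly (HB i) x * y) ^ q = poly (RA i) x + poly (RB i) x * y" for i
      proof -
        obtain a j e u where i: "i = (a, j, e, u)" by (cases i)
        have "poly (HA i) x + poly (HB i) x * y = x ^ (j + a * q) * ((if e then y else 1) * (if u then y ^ q else 1))"
          by (simp add: i HA_def HB_def poly_monom flip: P) (simp add: algebra_simps)
        moreover have "(x ^ (j + a * q)) ^ q = x ^ (j * q + a)"
          using xq by (simp add: power_add power_mult_distrib) (metis power_mult mult.commute)
        moreover have "((if e then y else 1) * (if u then y ^ q else 1)) ^ q = (if e then y ^ q else 1) * (if u then y else 1)"
          using yq by (simp add: power_mult_distrib)
        moreover have "poly (RA i) x + poly (RB i) x * y = x ^ (j * q + a) * ((if u then y else 1) * (if e then y ^ q else 1))"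
          by (simp add: i RA_def RB_def poly_monom flip: P) (simp add: algebra_simps)
        ultimately show ?thesis by (simp add: power_mult_distrib mult.commute)
      qed
      have "poly A x + poly B x * y = (\<Sum>i\<in>I. b i * (poly (HA i) x + poly (HB i) x * y))"
        by (simp add: A_def B_def poly_sum sum_distrib_right sum.distrib distrib_left mult.assoc)
      then have "(poly A x + poly B x * y) ^ q = (\<Sum>i\<in>I. c i * (poly (RA i) x + poly (RB i) x * y))"
        by (simp only: frq(2) power_mult_distrib b term_eq)
      also have "\<dots> = poly (\<Sum>i\<in>I. smult (c i) (RA i)) x + poly (\<Sum>i\<in>I. smult (c i) (RB i)) x * y"
        by (simp add: poly_sum sum_distrib_right sum.distrib distrib_left mult.assoc)
      also have "\<dots> = 0" by (simp add: RA0 RB0)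
      finally show ?thesis by simp
    qed
    obtain y where y: "y \<in> frob_fix (2 * h)" "y^2 + y = poly f x" using \<open>x \<in> S\<close> unfolding S_def by blast
    have "(y + 1)^2 + (y + 1) = poly f x" using y(2) by (simp add: power2_eq_square algebra_simps)
    then have "poly A x + poly B x * (y + 1) = 0"
      using y(1) by (intro * frob_fix_add) simp_all
    with *[OF y] show ?thesis by (simp add: distrib_left flip: add.assoc)
  qed
  have "A \<noteq> 0 \<or> B \<noteq> 0"
  proof (rule ccontr)
    assume "\<not> ?thesis"
    then have AB: "A = 0" "B = 0" by auto
    text \<open>Giving \<open>y\<close> the weight \<open>d\<close> and \<open>x\<close> the weight 2 makes all the functions \<open>HA i + HB i * y\<close>
      of different weight.\<close>
    define sq where "sq = (monom 1 2 :: 'k poly)"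
    have sq: "degree sq = 2" by (simp add: sq_def degree_monom_eq)
    \<comment> \<open>Substituting t^2 for x and t^d for y turns weights into degrees. The
      substitution does not respect the equation of the curve, but it does send A = B = 0 to a
      vanishing sum, which is all that has to be refuted.\<close>
    define W where "W e u = pcompose (PA e u) sq + monom 1 d * (pcompose (PB e u) sq)" for e u
    have dTX: "degree (pcompose T sq) = d * q" using degT sq qp by (simp add: degree_pcompose)
    have d0: "d > 0" and q1: "q > 1" using d gp qp by auto
    have dq: "d < d * q" using d0 q1 by simp
    have degW: "degree (W e u) = d * ((if e then 1 else 0) + (if u then q else 0))" for e u
    proof (cases u)
      case False
      then show ?thesis by (simp add: W_def PA_def PB_def degree_monom_eq pcompose_1)
    next
      case u: True
      show ?thesis
      proof (cases e)
        case False
        have "degree (monom 1 d :: 'k poly) < degree (pcompose T sq)" by (simp add: degree_monom_eq dTX dq)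
        then show ?thesis
          using u False by (simp add: W_def PA_def PB_def degree_add_eq_left dTX pcompose_1)
      next
        case True
        have 1: "degree (1 + pcompose T sq) = d * q"
          using dTX d0 q1 by (subst degree_add_eq_right) auto
        then have "1 + pcompose T sq \<noteq> 0" using d0 q1 by auto
        then have 2: "degree (monom 1 d * (1 + pcompose T sq)) = d + d * q"
          using 1 by (subst degree_mult_eq) (auto simp: degree_monom_eq)
        have "degree (pcompose f sq) = d * 2" using sq by (simp add: degree_pcompose d_def)
        then have "degree (pcompose f sq) < degree (monom 1 d * (1 + pcompose T sq))" unfolding 2 using dq by simp
        then have "degree (pcompose f sq + monom 1 d * (1 + pcompose T sq)) = d + d * q"
          using 2 by (simp only: degree_add_eq_right)
        then show ?thesis
          using u True by (simp add: W_def PA_def PB_def pcompose_add pcompose_1)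
      qed
    qed
    have W0: "W e u \<noteq> 0" for e u
    proof
      assume "W e u = 0"
      then have "d * ((if e then 1 else 0) + (if u then q else 0)) = 0" using degW[of e u] by simp
      then have "\<not> e" "\<not> u" using d0 q1 by (auto split: if_splits)
      with \<open>W e u = 0\<close> show False by (simp add: W_def PA_def PB_def pcompose_1)
    qed
    define G where "G = (\<lambda>(a, j, e, u). monom 1 (2 * (j + a * q)) * W e u)"
    have G: "pcompose (HA i) sq + monom 1 d * (pcompose (HB i) sq) = G i" for i
    proof -
      obtain a j e u where i: "i = (a, j, e, u)" by (cases i)
      have mX: "pcompose (monom 1 k) sq = monom 1 (2 * k)" for k
        by (induction k) (simp_all add: sq_def monom_Suc pcompose_pCons pcompose_mult mult_monom monom_0 one_pCons numeral_2_eq_2)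
      show ?thesis
        by (simp add: i HA_def HB_def G_def W_def pcompose_mult mX algebra_simps)
    qed
    have "(\<Sum>i\<in>I. smult (b i) (G i)) = pcompose A sq + monom 1 d * (pcompose B sq)"
      by (simp add: A_def B_def pcompose_sum pcompose_smult sum_distrib_left smult_add_right sum.distrib flip: G)
    then have zero: "(\<Sum>i\<in>I. smult (b i) (G i)) = 0" by (simp add: AB)
    define J where "J = {i \<in> I. b i \<noteq> 0}"
    have degG: "degree (G (a, j, e, u)) = (2 * j + (if e then d else 0)) + q * (2 * a + (if u then d else 0))" for a j e u
      using W0 by (simp add: G_def degree_mult_eq degree_monom_eq degW algebra_simps)
    have G0: "G i \<noteq> 0" for i using W0 by (cases i) (simp add: G_def)
    have "inj_on (\<lambda>i. degree (smult (b i) (G i))) J"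
    proof (rule inj_onI)
      fix i i' assume *: "i \<in> J" "i' \<in> J" "degree (smult (b i) (G i)) = degree (smult (b i') (G i'))"
      obtain a j e u where i: "i = (a, j, e, u)" by (cases i)
      obtain a' j' e' u' where i': "i' = (a', j', e', u')" by (cases i')
      have js: "j < s" "j' < s" using * by (auto simp: i i' J_def I_def)
      let ?l = "2 * j + (if e then d else 0)" and ?l' = "2 * j' + (if e' then d else 0)"
      let ?k = "2 * a + (if u then d else 0)" and ?k' = "2 * a' + (if u' then d else 0)"
      \<comment> \<open>\<open>?l\<close> is the last digit of the degree in base q, so
        \<open>?l\<close> and \<open>?k\<close> can be read off; since d is odd, their parities
        reveal e and u.\<close>
      have lt: "?l < q" "?l' < q" using js unfolding qp ps d by auto
      have eq: "?l + q * ?k = ?l' + q * ?k'" using * by (simp add: J_def i i' degG)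
      have "?l = ?l'" using arg_cong[OF eq, of "\<lambda>z. z mod q"] lt by simp
      moreover have "?k = ?k'" using eq \<open>?l = ?l'\<close> q1 by simp
      moreover have "z = z' \<and> v = v'" if "2 * z + (if v then d else 0) = 2 * z' + (if v' then d else 0)" for z z' :: nat and v v'
        using that unfolding d by (auto split: if_splits) presburger+
      ultimately show "i = i'" unfolding i i' by blast
    qed
    moreover have "J \<noteq> {}"
      using c(1) b by (auto simp: J_def q_def) (metis b q_def zero_neq_one frob_eq_zero_iff)
    moreover have "finite J" using finI by (simp add: J_def)
    ultimately have "(\<Sum>i\<in>J. smult (b i) (G i)) \<noteq> 0"
      using G0 by (intro sum_distinct_degrees_ne_0) (auto simp: J_def)
    moreover have "(\<Sum>i\<in>J. smult (b i) (G i)) = (\<Sum>i\<in>I. smult (b i) (G i))"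
      using finI by (intro sum.mono_neutral_left) (auto simp: J_def)
    ultimately show False using zero by simp
  qed
  moreover have degH: "degree (HA i) \<le> 2 * p * p + d * q" "degree (HB i) \<le> 2 * p * p + d * q" if "i \<in> I" for i
  proof -
    obtain a j e u where i: "i = (a, j, e, u)" by (cases i)
    then have aj: "a \<le> p + g" "j < s" using that by (auto simp: I_def M_def)
    have "a * q \<le> (p + g) * q" using aj by (intro mult_right_mono) auto
    then have "j + a * q + d * p \<le> s + (p + g) * q + d * p" using aj by linarith
    also have "\<dots> \<le> 2 * p * p + d * q"
      unfolding d qp ps by (auto simp: algebra_simps)
    finally have *: "j + a * q + d * p \<le> 2 * p * p + d * q" .
    show "degree (HA i) \<le> 2 * p * p + d * q" "degree (HB i) \<le> 2 * p * p + d * q"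
      unfolding i HA_def HB_def prod.case
      by (rule order.trans[OF degree_mult_le order.trans[OF add_mono[OF degree_monom_le degP(1)] *]])
         (rule order.trans[OF degree_mult_le order.trans[OF add_mono[OF degree_monom_le degP(2)] *]])
  qed
  have card_le: "card S \<le> 2 * p * p + d * q"
    if F: "F \<noteq> 0" "F = (\<Sum>i\<in>I. smult (b i) (H i))" "\<And>x. x \<in> S \<Longrightarrow> poly F x = 0"
      "\<And>i. i \<in> I \<Longrightarrow> degree (H i) \<le> 2 * p * p + d * q" for F H
  proof -
    have "card S \<le> card {x. poly F x = 0}"
      using F by (intro card_mono poly_roots_finite) auto
    also have "\<dots> \<le> degree F" using F(1) by (rule card_poly_roots_bound)
    also have "\<dots> \<le> 2 * p * p + d * q"
      unfolding F(2) by (intro degree_sum_le finI order.trans[OF degree_smult_le] F(4))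
    finally show ?thesis .
  qed
  ultimately have "card S \<le> 2 * p * p + d * q"
    using card_le[OF _ A_def _ degH(1)] card_le[OF _ B_def _ degH(2)] van by blast
  then show ?thesis
    unfolding Q S_def[symmetric] d_def[symmetric] q_def[symmetric] qp by (simp add: algebra_simps)
qed

end
section \<open>The coefficients of the L-function\<close>

text \<open>Here k counts iterates, not distinct points: if k is a multiple of the period, the orbit
  is repeated. For F the Frobenius map of the base field and x in its extension of degree k, these
  are the roots of the characteristic polynomial of x.\<close>

definition orbit_mset :: "('a \<Rightarrow> 'a) \<Rightarrow> 'a \<Rightarrow> nat \<Rightarrow> 'a multiset" where
  "orbit_mset F x k = (\<Sum>i<k. {#(F ^^ i) x#})"

lemma size_orbit_mset [simp]: "size (orbit_mset F x k) = k"
  by (induction k) (simp_all add: orbit_mset_def)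

lemma orbit_mset_add:
  "orbit_mset F x (a + b) = orbit_mset F x a + orbit_mset F ((F ^^ a) x) b"
  by (induction b) (simp_all add: orbit_mset_def funpow_add add.commute[of a] flip: funpow_swap1 add_mset_add_single)

lemma count_funpow_invariant:
  assumes "inj F" "image_mset F M = M"
  shows "count M ((F ^^ i) x) = count M x"
proof (induction i)
  case (Suc i)
  have "count (image_mset F M) (F y) = count M y" for y
    using assms(1) by (induction M) (auto simp: inj_eq)
  then show ?case
    using Suc assms(2) by simp
qed simp

text \<open>If D is the exact period of x, the admissible k are multiples D*i, for which the orbit
  multiset consists of i copies of one orbit. All points of the orbit have the same multiplicity in
  M, so i copies fit exactly for i <= \<open>count M x\<close>.\<close>

lemma card_periods_contained:
  assumes F: "inj F" and M: "image_mset F M = M" and x: "x \<in># M"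
  shows "card {k. k \<ge> 1 \<and> (F ^^ k) x = x \<and> orbit_mset F x k \<subseteq># M} = count M x"
proof -
  have "(F ^^ i) x \<in> set_mset M" for i
    using count_funpow_invariant[OF F M] x by (metis count_eq_zero_iff)
  then have "finite (range (\<lambda>i. (F ^^ i) x))"
    by (intro finite_subset[OF _ finite_set_mset[of M]]) auto
  then have "\<not> inj (\<lambda>i. (F ^^ i) x)"
    using finite_imageD[of "\<lambda>i. (F ^^ i) x" UNIV] by auto
  then obtain i' j' where ij': "i' \<noteq> j'" "(F ^^ i') x = (F ^^ j') x"
    by (auto simp: inj_def)
  then obtain i j where ij: "i < j" "(F ^^ i) x = (F ^^ j) x"
    by (cases i' j' rule: linorder_cases) auto
  have cancel: "(F ^^ i) a = (F ^^ i) b \<Longrightarrow> a = b" for i a b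
    using inj_fn[OF F, of i] by (auto simp: inj_eq)
  have per: "(F ^^ (j - i)) x = x" if "i < j" "(F ^^ i) x = (F ^^ j) x" for i j
  proof -
    have "(F ^^ i) ((F ^^ (j - i)) x) = (F ^^ i) x"
      using that by (simp flip: funpow_add[THEN fun_cong, unfolded o_apply])
    then show ?thesis by (rule cancel)
  qed
  define D where "D = (LEAST k. k \<ge> 1 \<and> (F ^^ k) x = x)"
  have "\<exists>k. k \<ge> 1 \<and> (F ^^ k) x = x"
    using per[OF ij] ij(1) by (intro exI[of _ "j - i"]) auto
  then have D: "D \<ge> 1" "(F ^^ D) x = x"
    unfolding D_def by (metis (mono_tags, lifting) LeastI_ex)+
  have least: "k \<ge> D" if "k \<ge> 1" "(F ^^ k) x = x" for k
    unfolding D_def using that by (intro Least_le) auto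
  have dvd: "(F ^^ k) x = x \<longleftrightarrow> D dvd k" for k
  proof -
    have "(F ^^ (k mod D)) x = x \<longleftrightarrow> k mod D = 0"
      using least[of "k mod D"] D(1) mod_less_divisor[of D k] by (cases "k mod D = 0") fastforce+
    then show ?thesis
      using funpow_mod_eq[OF D(2), of k] by (simp add: mod_eq_0_iff_dvd)
  qed
  have rep: "orbit_mset F x (D * i) = repeat_mset i (orbit_mset F x D)" for i
  proof (induction i)
    case (Suc i)
    have "(F ^^ (D * i)) x = x" by (simp add: dvd)
    then show ?case
      using orbit_mset_add[of F x "D * i" D] by (simp add: Suc add.commute)
  qed (simp add: orbit_mset_def)
  have inj: "i = j" if "i < D" "j < D" "(F ^^ i) x = (F ^^ j) x" for i j
    using that per[of i j] per[of j i] least[of "j - i"] least[of "i - j"]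
    by (cases i j rule: linorder_cases) fastforce+
  have le1: "count (orbit_mset F x D) y \<le> 1" for y
  proof (cases "\<exists>i<D. (F ^^ i) x = y")
    case True
    then obtain i where i: "i < D" "(F ^^ i) x = y" by auto
    have "count (orbit_mset F x D) y = (\<Sum>j<D. if j = i then 1 else 0)"
      using i inj unfolding orbit_mset_def count_sum by (intro sum.cong) auto
    then show ?thesis using i by simp
  qed (auto simp: orbit_mset_def count_sum)
  have ge1: "count (orbit_mset F x D) ((F ^^ i) x) \<ge> 1" if "i < D" for i
    using that member_le_sum[of i "{..<D}" "\<lambda>j. count {#(F ^^ j) x#} ((F ^^ i) x)"]
    by (simp add: orbit_mset_def count_sum)
  have sub: "orbit_mset F x (D * i) \<subseteq># M \<longleftrightarrow> i \<le> count M x" for i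
  proof
    assume *: "orbit_mset F x (D * i) \<subseteq># M"
    have "i * 1 \<le> i * count (orbit_mset F x D) x"
      using ge1[of 0] D(1) by (intro mult_left_mono) auto
    also have "\<dots> \<le> count M x"
      using mset_subset_eq_count[OF *, of x] by (simp add: rep)
    finally show "i \<le> count M x" by simp
  next
    assume *: "i \<le> count M x"
    show "orbit_mset F x (D * i) \<subseteq># M"
    proof (rule mset_subset_eqI)
      fix y
      show "count (orbit_mset F x (D * i)) y \<le> count M y"
      proof (cases "\<exists>j<D. (F ^^ j) x = y")
        case True
        then have "count M y = count M x" using count_funpow_invariant[OF F M] by auto
        moreover have "i * count (orbit_mset F x D) y \<le> i * 1"
          using le1[of y] by (intro mult_left_mono) auto
        ultimately show ?thesis using * by (simp only: rep count_repeat_mset)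
      next
        case False
        then have "count (orbit_mset F x D) y = 0" by (auto simp: orbit_mset_def count_sum)
        then show ?thesis by (simp add: rep)
      qed
    qed
  qed
  have "{k. k \<ge> 1 \<and> (F ^^ k) x = x \<and> orbit_mset F x k \<subseteq># M} = (\<lambda>i. D * i) ` {1..count M x}"
  proof safe
    fix k assume "1 \<le> k" "(F ^^ k) x = x" "orbit_mset F x k \<subseteq># M"
    then show "k \<in> (\<lambda>i. D * i) ` {1..count M x}"
      using sub by (auto simp: dvd elim!: dvdE)
  qed (use D(1) sub in \<open>auto simp: dvd\<close>)
  then show ?thesis
    using D(1) by (simp add: card_image inj_on_def)
qed

text \<open>Summing the multiplicities over the elements of M. This count replaces the logarithmic
  derivative of an Euler product.\<close>

lemma card_all_periods_contained:
  assumes F: "inj F" and M: "image_mset F M = M"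
  shows "card {(k, x). 1 \<le> k \<and> (F ^^ k) x = x \<and> orbit_mset F x k \<subseteq># M} = size M"
proof -
  define P where "P x = {k. k \<ge> 1 \<and> (F ^^ k) x = x \<and> orbit_mset F x k \<subseteq># M}" for x
  have mem: "x \<in># M" if "k \<in> P x" for k x
  proof -
    have "count {#(F ^^ 0) x#} x \<le> count (orbit_mset F x k) x"
      using that unfolding orbit_mset_def count_sum by (intro member_le_sum) (auto simp: P_def)
    then have "x \<in># orbit_mset F x k" by (simp add: Suc_le_eq)
    then show ?thesis using that by (auto simp: P_def dest: mset_subset_eqD)
  qed
  have "P x \<subseteq> {..size M}" for x
    by (auto simp: P_def dest!: size_mset_mono)
  then have fin: "finite (P x)" for x
    using finite_subset by blast
  have "{(k, x). 1 \<le> k \<and> (F ^^ k) x = x \<and> orbit_mset F x k \<subseteq># M} = prod.swap ` (SIGMA x:set_mset M. P x)"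
    using mem by (force simp: P_def)
  then have "card {(k, x). 1 \<le> k \<and> (F ^^ k) x = x \<and> orbit_mset F x k \<subseteq># M} = card (SIGMA x:set_mset M. P x)"
    by (simp add: card_image)
  also have "\<dots> = (\<Sum>x\<in>set_mset M. card (P x))"
    using fin by simp
  also have "\<dots> = (\<Sum>x\<in>set_mset M. count M x)"
    using card_periods_contained[OF F M] by (simp add: P_def)
  finally show ?thesis
    by (simp add: size_multiset_overloaded_eq)
qed

context closed_char2
begin

text \<open>The root multisets of the monic polynomials of degree n over \<open>frob_fix m\<close>.
  As multisets, like effective divisors, they can be added and subtracted.\<close>

definition frob_mset :: "nat \<Rightarrow> nat \<Rightarrow> 'k multiset set" where
  "frob_mset m n = {M. size M = n \<and> image_mset (\<lambda>x. x ^ 2 ^ m) M = M}"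

definition frob_poly_set :: "nat \<Rightarrow> nat \<Rightarrow> 'k poly set" where
  "frob_poly_set m n = {p. degree p = n \<and> lead_coeff p = 1 \<and> (\<forall>i. coeff p i \<in> frob_fix m)}"

lemma map_poly_frob_mult:
  "map_poly (\<lambda>x. x ^ 2 ^ m) (p * r :: 'k poly) = map_poly (\<lambda>x. x ^ 2 ^ m) p * map_poly (\<lambda>x. x ^ 2 ^ m) r"
  by (rule poly_eqI) (simp add: coeff_map_poly coeff_mult frob_sum power_mult_distrib power_0_left)

lemma map_poly_frob_prod_mset:
  "map_poly (\<lambda>x. x ^ 2 ^ m) (\<Prod>x\<in>#M. [:-x, 1:] :: 'k poly) = (\<Prod>x\<in>#image_mset (\<lambda>x. x ^ 2 ^ m) M. [:-x, 1:])"
proof (induction M)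
  case (add x M)
  have "map_poly (\<lambda>x. x ^ 2 ^ m) [:-x, 1:] = [:- (x ^ 2 ^ m), 1:]"
    by (simp add: map_poly_pCons power_0_left uminus_CHAR_2[OF char2])
  then show ?case
    using add by (simp add: map_poly_frob_mult del: mult_pCons_left)
qed (simp add: map_poly_1')

lemma degree_prod_mset_linear: "degree (\<Prod>x\<in>#M. [:-x, 1:] :: 'k poly) = size M"
proof (induction M)
  case (add x M)
  then show ?case
    using prod_mset_linear_ne_0[of M] by (simp add: degree_mult_eq del: mult_pCons_left)
qed simp

lemma lead_coeff_prod_mset_linear: "lead_coeff (\<Prod>x\<in>#M. [:-x, 1:] :: 'k poly) = 1"
proof (induction M)
  case (add x M)
  then show ?case
    by (simp only: image_mset_add_mset prod_mset.add_mset lead_coeff_mult) simp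
qed simp

lemma bij_betw_proots: "bij_betw proots (frob_poly_set m n) (frob_mset m n)"
proof (rule bij_betw_byWitness[where f' = "\<lambda>M. \<Prod>x\<in>#M. [:-x, 1:]"])
  show "\<forall>p\<in>frob_poly_set m n. (\<Prod>x\<in>#proots p. [:-x, 1:]) = p"
    using poly_eq_prod_mset_proots(1) by (metis (mono_tags, lifting) frob_poly_set_def mem_Collect_eq)
  show "\<forall>M\<in>frob_mset m n. proots (\<Prod>x\<in>#M. [:-x, 1:]) = M"
    by (simp add: proots_prod_mset_linear)
  show "proots ` frob_poly_set m n \<subseteq> frob_mset m n"
  proof safe
    fix p assume p: "p \<in> frob_poly_set m n"
    then have *: "p = (\<Prod>x\<in>#proots p. [:-x, 1:])" "size (proots p) = n"
      using poly_eq_prod_mset_proots[of p] by (auto simp: frob_poly_set_def)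
    have "map_poly (\<lambda>x. x ^ 2 ^ m) p = p"
      using p by (intro poly_eqI) (simp add: coeff_map_poly power_0_left frob_poly_set_def frob_fix_def)
    then have "(\<Prod>x\<in>#image_mset (\<lambda>x. x ^ 2 ^ m) (proots p). [:-x, 1:]) = (\<Prod>x\<in>#proots p. [:-x, 1:])"
      using map_poly_frob_prod_mset[of m "proots p"] *(1) by simp
    then have "image_mset (\<lambda>x. x ^ 2 ^ m) (proots p) = proots p"
      by (metis proots_prod_mset_linear)
    then show "proots p \<in> frob_mset m n"
      using *(2) by (simp add: frob_mset_def)
  qed
  show "(\<lambda>M. \<Prod>x\<in>#M. [:-x, 1:]) ` frob_mset m n \<subseteq> frob_poly_set m n"
  proof safe
    fix M assume M: "M \<in> frob_mset m n"
    let ?p = "\<Prod>x\<in>#M. [:-x, 1:] :: 'k poly"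
    have "map_poly (\<lambda>x. x ^ 2 ^ m) ?p = ?p"
      using M by (simp add: map_poly_frob_prod_mset frob_mset_def del: multiset.map_comp)
    then have "coeff ?p i ^ 2 ^ m = coeff ?p i" for i
      by (metis (no_types, lifting) coeff_map_poly power_0_left power_eq_0_iff frob_eq_zero_iff)
    then show "?p \<in> frob_poly_set m n"
      using M degree_prod_mset_linear[of M] lead_coeff_prod_mset_linear[of M]
      by (auto simp: frob_poly_set_def frob_mset_def frob_fix_def)
  qed
qed

lemma finite_frob_poly_set: assumes "m > 0" shows "finite (frob_poly_set m n)"
proof -
  have "frob_poly_set m n \<subseteq> Poly ` {xs. set xs \<subseteq> frob_fix m \<and> length xs = n + 1}"
  proof
    fix p assume p: "p \<in> frob_poly_set m n"
    then have "p \<noteq> 0" by (auto simp: frob_poly_set_def)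
    then have "length (coeffs p) = n + 1" "set (coeffs p) \<subseteq> frob_fix m"
      using p by (auto simp: frob_poly_set_def length_coeffs_degree coeffs_def)
    then show "p \<in> Poly ` {xs. set xs \<subseteq> frob_fix m \<and> length xs = n + 1}"
      by (intro image_eqI[of _ _ "coeffs p"]) auto
  qed
  then show ?thesis
    using finite_lists_length_eq[OF finite_frob_fix(1)[OF assms]] finite_subset by blast
qed

lemma finite_frob_mset: "m > 0 \<Longrightarrow> finite (frob_mset m n)"
  using bij_betw_finite[OF bij_betw_proots] finite_frob_poly_set by blast

definition chi :: "nat \<Rightarrow> 'k poly \<Rightarrow> 'k multiset \<Rightarrow> int" where
  "chi m f M = psi m (\<Sum>x\<in>#M. poly f x)"

text \<open>The n-th coefficient of the L-function of the character given by f, as a sum over monic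
  polynomials of degree n.\<close>

definition L_coeff :: "nat \<Rightarrow> 'k poly \<Rightarrow> nat \<Rightarrow> int" where
  "L_coeff m f n = (\<Sum>M\<in>frob_mset m n. chi m f M)"

definition char_sum :: "nat \<Rightarrow> 'k poly \<Rightarrow> int" where
  "char_sum N f = (\<Sum>x\<in>frob_fix N. psi N (poly f x))"

lemma frob_inj_fun: "inj (\<lambda>x::'k. x ^ 2 ^ m)"
  by (rule injI) (simp add: frob_inj)

lemma sum_mset_frob: "(\<Sum>x\<in>#M. g x :: 'k) ^ 2 ^ m = (\<Sum>x\<in>#M. g x ^ 2 ^ m)"
  by (induction M) (simp_all add: frob_add power_0_left)

lemma sum_poly_frob_mset:
  assumes f: "\<And>i. coeff f i \<in> frob_fix m" and M: "M \<in> frob_mset m n"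
  shows "(\<Sum>x\<in>#M. poly f x) \<in> frob_fix m"
proof -
  have "(\<Sum>x\<in>#M. poly f x) ^ 2 ^ m = (\<Sum>x\<in>#M. poly f (x ^ 2 ^ m))"
    using frob_poly[OF f, where k = 1] by (simp add: sum_mset_frob)
  also have "\<dots> = (\<Sum>x\<in>#image_mset (\<lambda>x. x ^ 2 ^ m) M. poly f x)"
    by (simp add: image_mset.compositionality o_def)
  also have "\<dots> = (\<Sum>x\<in>#M. poly f x)"
    using M by (simp add: frob_mset_def del: multiset.map_comp)
  finally show ?thesis by (simp add: frob_fix_def)
qed

text \<open>The coefficient form of X * L' = L * (sum of S_k * X^k), with S_k the character sum over
  the extension of degree k. A term on the right is a point x of that extension with a stable
  multiset of size n - k; joining the orbit of x gives a stable multiset M of size n whose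
  \<open>chi\<close> is the product. Each M arises n times, by
  \<open>card_all_periods_contained\<close>.\<close>

theorem L_coeff_recursion:
  assumes m: "m > 0" and f: "\<And>i. coeff f i \<in> frob_fix m"
  shows "int n * L_coeff m f n = (\<Sum>k = 1..n. char_sum (m * k) f * L_coeff m f (n - k))"
proof -
  define F :: "'k \<Rightarrow> 'k" where "F = (\<lambda>x. x ^ 2 ^ m)"
  have injF: "inj F" by (simp add: F_def frob_inj_fun)
  have Fk: "(F ^^ k) x = x ^ 2 ^ (m * k)" for k x by (simp add: F_def frob_iter)
  have fix_iff: "x \<in> frob_fix (m * k) \<longleftrightarrow> (F ^^ k) x = x" for k x by (simp add: Fk frob_fix_def)
  have orb: "orbit_mset F x k \<in> frob_mset m k" if "(F ^^ k) x = x" for x k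
  proof -
    have "image_mset F (orbit_mset F x k) + {#x#} = orbit_mset F x k + {#(F ^^ k) x#}"
      by (induction k) (simp_all add: orbit_mset_def)
    then show ?thesis using that by (simp add: frob_mset_def F_def)
  qed
  have chi_orb: "chi m f (orbit_mset F x k) = psi (m * k) (poly f x)" for x k
  proof -
    have "(\<Sum>y\<in>#orbit_mset F x k. poly f y) = (\<Sum>i<k. poly f ((F ^^ i) x))"
      by (induction k) (simp_all add: orbit_mset_def)
    also have "\<dots> = (\<Sum>i<k. poly f x ^ 2 ^ (m * i))"
      by (simp add: Fk frob_poly[OF f])
    finally show ?thesis by (simp add: chi_def psi_mult_degree)
  qed
  have chi_add: "chi m f (M + M') = chi m f M * chi m f M'" if "M \<in> frob_mset m a" "M' \<in> frob_mset m b" for M M' a b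
    using that by (simp add: chi_def psi_add sum_poly_frob_mset[OF f])
  define Q where "Q M = {(k, x). 1 \<le> k \<and> (F ^^ k) x = x \<and> orbit_mset F x k \<subseteq># M}" for M
  have Qle: "k \<le> n" if "(k, x) \<in> Q M" "M \<in> frob_mset m n" for k x M
    using that by (auto simp: Q_def frob_mset_def dest!: size_mset_mono)
  have finQ: "finite (Q M)" if "M \<in> frob_mset m n" for M
  proof (rule finite_subset)
    show "Q M \<subseteq> (SIGMA k:{1..n}. frob_fix (m * k))"
      using Qle[OF _ that] by (auto simp: fix_iff) (auto simp: Q_def)
  qed (use m in \<open>auto intro!: finite_frob_fix\<close>)
  have cardQ: "card (Q M) = n" if "M \<in> frob_mset m n" for M
    using card_all_periods_contained[OF injF, of M] that by (simp add: Q_def frob_mset_def F_def)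
  have "(\<Sum>k = 1..n. char_sum (m * k) f * L_coeff m f (n - k))
    = (\<Sum>k = 1..n. \<Sum>x\<in>frob_fix (m * k). \<Sum>M\<in>frob_mset m (n - k). chi m f (orbit_mset F x k + M))"
    unfolding char_sum_def L_coeff_def sum_product
    by (intro sum.cong refl) (subst chi_add[OF orb], auto simp: fix_iff chi_orb)
  also have "\<dots> = (\<Sum>(k, x, M)\<in>(SIGMA k:{1..n}. frob_fix (m * k) \<times> frob_mset m (n - k)). chi m f (orbit_mset F x k + M))"
    using m by (simp add: sum.Sigma finite_frob_fix finite_frob_mset split_def flip: sum.cartesian_product)
  also have "\<dots> = (\<Sum>(M, k, x)\<in>(SIGMA M:frob_mset m n. Q M). chi m f M)"
  proof (rule sum.reindex_bij_witness[of _ "\<lambda>(M, k, x). (k, x, M - orbit_mset F x k)" "\<lambda>(k, x, M). (orbit_mset F x k + M, k, x)"], goal_cases)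
    case (2 t)
    then show ?case using orb by (force simp: Q_def frob_mset_def fix_iff F_def)
  next
    case (4 t)
    then obtain M k x where t: "t = (M, k, x)" "M \<in> frob_mset m n" "(k, x) \<in> Q M" by auto
    have "image_mset F (M - orbit_mset F x k) = image_mset F M - image_mset F (orbit_mset F x k)"
      using t by (intro image_mset_Diff) (simp add: Q_def)
    also have "\<dots> = M - orbit_mset F x k"
      using t orb[of k x] by (simp add: frob_mset_def F_def Q_def)
    finally show ?case
      using t Qle[OF t(3,2)] by (auto simp: Q_def fix_iff frob_mset_def F_def size_Diff_submset)
  qed (auto simp: Q_def)
  also have "\<dots> = (\<Sum>M\<in>frob_mset m n. \<Sum>(k, x)\<in>Q M. chi m f M)"
    using m by (subst sum.Sigma) (auto simp: finite_frob_mset finQ)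
  also have "\<dots> = int n * L_coeff m f n"
    by (simp add: L_coeff_def cardQ sum_distrib_left split_def)
  finally show ?thesis ..
qed

end

section \<open>Newton's identities and the vanishing of the higher L-coefficients\<close>

lemma fps_of_reflect_prod_mset:
  "fps_of_poly (reflect_poly (\<Prod>x\<in>#M. [:-x, 1:])) = (\<Prod>x\<in>#M. 1 - fps_const x * fps_X :: 'a::field fps)"
proof (induction M)
  case (add x M)
  have "reflect_poly [:-x, 1:] = [:1, -x:]"
    by (simp add: reflect_poly_def coeffs_pCons_eq_cCons cCons_def)
  moreover have "fps_of_poly [:1, -x:] = (1 - fps_const x * fps_X :: 'a fps)"
    by (rule fps_ext) (auto simp: coeff_pCons split: nat.split)
  ultimately show ?case
    using add by (simp add: reflect_poly_mult fps_of_poly_mult del: mult_pCons_left)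
qed simp

text \<open>The logarithmic derivative of a product of factors 1 - x*X, one factor at a time;
  \<open>G\<close> is the geometric series contributed by the new factor.\<close>

lemma newton_fps:
  fixes M :: "'a::field multiset"
  defines "R \<equiv> \<lambda>M. \<Prod>x\<in>#M. 1 - fps_const x * fps_X :: 'a fps"
  defines "P \<equiv> \<lambda>M. Abs_fps (\<lambda>k. if k = 0 then 0 else \<Sum>x\<in>#M. x ^ k) :: 'a fps"
  shows "fps_X * fps_deriv (R M) = - (R M * P M)"
proof (induction M)
  case (add x M)
  define G where "G = Abs_fps (\<lambda>k. if k = 0 then 0 else x ^ k)"
  define L where "L = (1 - fps_const x * fps_X :: 'a fps)"
  have P: "P (add_mset x M) = P M + G"
    by (rule fps_ext) (simp add: P_def G_def add.commute)
  have LG: "L * G = fps_const x * fps_X"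
  proof (rule fps_ext)
    fix n show "fps_nth (L * G) n = fps_nth (fps_const x * fps_X) n"
      by (cases n) (auto simp: L_def G_def left_diff_distrib mult.assoc)
  qed
  have dL: "fps_deriv L = - fps_const x"
    by (simp add: L_def)
  have RL: "R (add_mset x M) = L * R M"
    by (simp add: R_def L_def)
  have "fps_X * fps_deriv (R (add_mset x M)) = - ((fps_const x * fps_X) * R M) + L * (fps_X * fps_deriv (R M))"
    unfolding RL fps_deriv_mult dL by (simp add: algebra_simps flip: fps_const_neg)
  also have "\<dots> = - ((L * R M) * (P M + G))"
    unfolding add LG[symmetric] by (simp only: algebra_simps) simp
  finally show ?case
    unfolding P RL .
qed (simp add: R_def P_def fps_zero_def[symmetric] flip: fps_zero_def, simp add: fps_eq_iff)

text \<open>Solved for the power sum, so that nothing is divided by k: the identity is used both in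
  characteristic two and over the complex numbers.\<close>

lemma newton_identity:
  fixes M :: "'a::field multiset"
  defines "c \<equiv> coeff (reflect_poly (\<Prod>x\<in>#M. [:-x, 1:]))"
  assumes k: "0 < k"
  shows "(\<Sum>x\<in>#M. x ^ k) = - of_nat k * c k - (\<Sum>i=1..<k. c i * (\<Sum>x\<in>#M. x ^ (k - i)))"
proof -
  define P where "P = (Abs_fps (\<lambda>k. if k = 0 then 0 else \<Sum>x\<in>#M. x ^ k))"
  define R where "R = fps_of_poly (reflect_poly (\<Prod>x\<in>#M. [:-x, 1:]))"
  have R: "fps_nth R i = c i" for i
    by (simp add: R_def c_def)
  have "lead_coeff (\<Prod>x\<in>#M. [:-x, 1:]) = 1"
    by (induction M) (simp_all add: lead_coeff_mult del: mult_pCons_left)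
  then have c0: "c 0 = 1"
    by (simp add: c_def)
  have eq: "fps_X * fps_deriv R = - (R * P)"
    unfolding R_def P_def fps_of_reflect_prod_mset by (rule newton_fps)
  have "of_nat k * c k = fps_nth (fps_X * fps_deriv R) k"
    using k R by simp
  also have "\<dots> = - fps_nth (R * P) k"
    unfolding eq by simp
  also have "fps_nth (R * P) k = (\<Sum>i=0..<k. fps_nth R i * fps_nth P (k - i))"
    unfolding fps_mult_nth by (simp add: sum.last_plus P_def flip: atLeastLessThanSuc_atLeastAtMost)
  also have "\<dots> = fps_nth P k + (\<Sum>i=1..<k. fps_nth R i * fps_nth P (k - i))"
    using k by (simp add: sum.atLeast_Suc_lessThan R c0)
  also have "\<dots> = (\<Sum>x\<in>#M. x ^ k) + (\<Sum>i=1..<k. c i * (\<Sum>x\<in>#M. x ^ (k - i)))"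
    using k by (auto simp: P_def R intro!: arg_cong2[of _ _ _ _ "(+)"] sum.cong)
  finally show ?thesis
    by (metis (no_types, lifting) add_diff_cancel_right' minus_equation_iff minus_mult_left)
qed

context closed_char2
begin

text \<open>The k-th power sum depends only on the first k elementary symmetric functions. Of the
  first d only the d-th is changed, and it enters the d-th power sum with factor d, up to a sign
  that characteristic two ignores.\<close>

lemma power_sums_perturb:
  fixes p :: "'k poly"
  assumes p: "lead_coeff p = 1" "degree p = n" and d: "0 < d" "d \<le> n" and k: "k \<le> d"
  shows "(\<Sum>x\<in>#proots (p + monom u (n - d)). x ^ k)
           = (\<Sum>x\<in>#proots p. x ^ k) + (if k = d then of_nat d * u else 0)"
proof -
  define p' where "p' = p + monom u (n - d)"
  have lt: "degree (monom u (n - d)) < degree p"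
    using d p by (intro le_less_trans[OF degree_monom_le]) simp
  have p': "degree p' = n" "lead_coeff p' = 1"
    using p lt d by (simp_all add: p'_def degree_add_eq_left)
  note pp = poly_eq_prod_mset_proots(1)[OF p(1)] and pp' = poly_eq_prod_mset_proots(1)[OF p'(2)]
  define c where "c p = coeff (reflect_poly p)" for p :: "'k poly"
  have co: "c p' i = c p i + (if i = d then u else 0)" if "i \<le> d" for i
    using that d p p' by (auto simp: c_def coeff_reflect_poly) (auto simp: p'_def)
  show ?thesis
    using k unfolding p'_def[symmetric]
  proof (induction k rule: less_induct)
    case (less k)
    show ?case
    proof (cases "k = 0")
      case True
      then show ?thesis
        using d p' p poly_eq_prod_mset_proots(2)[of p] poly_eq_prod_mset_proots(2)[of p'] by simp
    next
      case False
      then have k: "0 < k" "k \<le> n" using less.prems d by auto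
      have "(\<Sum>i=1..<k. c p' i * (\<Sum>x\<in>#proots p'. x ^ (k - i)))
          = (\<Sum>i=1..<k. c p i * (\<Sum>x\<in>#proots p. x ^ (k - i)))"
        using less by (intro sum.cong) (auto simp: co)
      then show ?thesis
        unfolding newton_identity[OF k(1), of "proots p", folded pp, folded c_def]
          newton_identity[OF k(1), of "proots p'", folded pp', folded c_def]
        using co[OF less.prems] by (simp add: minus_eq_add uminus_CHAR_2[OF char2] algebra_simps)
    qed
  qed
qed

text \<open>For n >= d = \<open>degree f\<close> the monic polynomials of degree n are permuted by
  adding u * X^(n-d), which shifts the argument of \<open>psi\<close> by
  \<open>coeff f d * u\<close> because d is odd. Averaging over u leaves the sum of a nontrivial
  character.\<close>

theorem L_coeff_eq_0:
  assumes m: "m > 0" and f: "\<And>i. coeff f i \<in> frob_fix m" and d: "odd (degree f)" "degree f \<le> n"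
  shows "L_coeff m f n = 0"
proof -
  define d where "d = degree f"
  define s where "s p = (\<Sum>x\<in>#proots p. poly f x)" for p
  have dn: "0 < d" "d \<le> n" using d by (auto simp: d_def intro: Nat.gr0I)
  have s: "s p = (\<Sum>j\<le>d. coeff f j * (\<Sum>x\<in>#proots p. x ^ j))" for p
  proof -
    have "(\<Sum>x\<in>#M. poly f x) = (\<Sum>j\<le>d. coeff f j * (\<Sum>x\<in>#M. x ^ j))" for M
      by (induction M) (simp_all add: poly_altdef d_def distrib_left sum.distrib)
    then show ?thesis by (simp add: s_def)
  qed
  have odd1: "of_nat d = (1::'k)"
    using d(1) by (auto simp: d_def two_eq_zero elim!: oddE)
  have shift: "s (p + monom u (n - d)) = s p + coeff f d * u" if "p \<in> frob_poly_set m n" for p u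
  proof -
    have "s (p + monom u (n - d)) = (\<Sum>j\<le>d. coeff f j * ((\<Sum>x\<in>#proots p. x ^ j) + (if j = d then of_nat d * u else 0)))"
      unfolding s using that dn power_sums_perturb[of p n d]
      by (intro sum.cong refl arg_cong2[of _ _ _ _ "(*)"]) (auto simp: frob_poly_set_def)
    also have "\<dots> = s p + (\<Sum>j\<le>d. if j = d then coeff f j * u else 0)"
      unfolding s distrib_left sum.distrib odd1 by (intro arg_cong2[of _ _ _ _ "(+)"] sum.cong) auto
    finally show ?thesis by simp
  qed
  have mem: "p + monom u (n - d) \<in> frob_poly_set m n" if "p \<in> frob_poly_set m n" "u \<in> frob_fix m" for p u
  proof -
    have "degree (monom u (n - d)) < degree p"
      using dn that(1) by (intro le_less_trans[OF degree_monom_le]) (simp add: frob_poly_set_def)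
    then have "degree (p + monom u (n - d)) = n" "coeff (p + monom u (n - d)) n = 1"
      using that dn by (auto simp: frob_poly_set_def degree_add_eq_left)
    then show ?thesis
      using that by (auto simp: frob_poly_set_def intro!: frob_fix_add)
  qed
  have s_fix: "s p \<in> frob_fix m" if "p \<in> frob_poly_set m n" for p
    unfolding s_def using bij_betwE[OF bij_betw_proots] that by (intro sum_poly_frob_mset[OF f]) blast
  have L: "L_coeff m f n = (\<Sum>p\<in>frob_poly_set m n. psi m (s p))"
    unfolding L_coeff_def chi_def s_def by (rule sum.reindex_bij_betw[OF bij_betw_proots, symmetric])
  have "L_coeff m f n = (\<Sum>p\<in>frob_poly_set m n. psi m (s p) * psi m (coeff f d * u))" if "u \<in> frob_fix m" for u
  proof -
    have "L_coeff m f n = (\<Sum>p\<in>frob_poly_set m n. psi m (s (p + monom u (n - d))))"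
      unfolding L using mem that
      by (intro sum.reindex_bij_witness[of _ "\<lambda>p. p + monom u (n - d)" "\<lambda>p. p + monom u (n - d)"])
         (auto simp: add.assoc add_monom)
    also have "\<dots> = (\<Sum>p\<in>frob_poly_set m n. psi m (s p) * psi m (coeff f d * u))"
      using that s_fix f by (intro sum.cong) (auto simp: shift psi_add frob_fix_mult)
    finally show ?thesis .
  qed
  then have "(\<Sum>u\<in>frob_fix m. L_coeff m f n) = (\<Sum>u\<in>frob_fix m. \<Sum>p\<in>frob_poly_set m n. psi m (s p) * psi m (coeff f d * u))"
    by (intro sum.cong) auto
  also have "\<dots> = (\<Sum>p\<in>frob_poly_set m n. psi m (s p) * (\<Sum>u\<in>frob_fix m. psi m (coeff f d * u)))"
    by (subst sum.swap) (simp add: sum_distrib_left)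
  also have "\<dots> = 0"
    using sum_psi_mult_eq_0[OF m f, of d] dn degree_0 by (cases "f = 0") (auto simp: d_def)
  finally show ?thesis
    by (simp add: card_frob_fix m)
qed

end
section \<open>The Weil bound\<close>

text \<open>Some polynomial vanishes at all elements of W except w. Combining consecutive power sums
  with its coefficients isolates a nonzero constant times w^k, which cannot stay within a constant
  times r^k if w is larger than r.\<close>

lemma norm_le_of_power_sums_le:
  fixes W :: "complex multiset"
  assumes r: "r > 0" and w: "w \<in># W"
    and bound: "\<And>k. k \<ge> k0 \<Longrightarrow> norm (\<Sum>z\<in>#W. z ^ k) \<le> C * r ^ k"
  shows "norm w \<le> r"
proof (rule ccontr)
  assume "\<not> norm w \<le> r"
  then have gt: "norm w / r > 1" using r by (simp add: field_simps)
  define p where "p = (\<Prod>z\<in>set_mset W - {w}. [:-z, 1:])"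
  define D where "D = real (count W w) * norm (poly p w)"
  have D: "D > 0"
    using w by (auto simp: D_def p_def poly_prod)
  define E where "E = (\<Sum>l\<le>degree p. norm (coeff p l) * (C * r ^ l))"
  have eq: "(\<Sum>l\<le>degree p. coeff p l * (\<Sum>z\<in>#W. z ^ (k + l))) = of_nat (count W w) * (w ^ k * poly p w)" for k
  proof -
    have "(\<Sum>l\<le>degree p. coeff p l * (\<Sum>z\<in>#V. z ^ (k + l))) = (\<Sum>z\<in>#V. z ^ k * poly p z)" for V
      by (induction V) (simp_all add: poly_altdef sum.distrib distrib_left sum_distrib_left power_add mult_ac)
    also have "(\<Sum>z\<in>#W. z ^ k * poly p z) = (\<Sum>z\<in>#W. if z = w then w ^ k * poly p w else 0)"
      by (intro arg_cong[of _ _ sum_mset] image_mset_cong) (auto simp: p_def poly_prod)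
    also have "(\<Sum>z\<in>#V. if z = w then c else 0) = of_nat (count V w) * c" for V and c :: complex
      by (induction V) (auto simp: algebra_simps)
    finally show ?thesis .
  qed
  have le: "(norm w / r) ^ k \<le> E / D" if "k \<ge> k0" for k
  proof -
    have "D * norm w ^ k = norm (\<Sum>l\<le>degree p. coeff p l * (\<Sum>z\<in>#W. z ^ (k + l)))"
      unfolding eq by (simp add: D_def norm_mult norm_power mult_ac)
    also have "\<dots> \<le> (\<Sum>l\<le>degree p. norm (coeff p l) * (C * r ^ (k + l)))"
      using that by (intro order.trans[OF norm_sum] sum_mono) (simp only: norm_mult, intro mult_left_mono bound, auto)
    also have "\<dots> = E * r ^ k"
      by (simp add: E_def power_add sum_distrib_left mult_ac)
    finally show ?thesis
      using r D by (simp add: field_simps)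
  qed
  obtain K where K: "E / D < (norm w / r) ^ K"
    using real_arch_pow[OF gt] by blast
  also have "\<dots> \<le> (norm w / r) ^ (K + k0)"
    using gt by (intro power_increasing) auto
  also have "\<dots> \<le> E / D" by (intro le) simp
  finally show False by simp
qed

context closed_char2
begin

lemma char_sum_eq_card:
  assumes N: "N > 0" and f: "\<And>x. x \<in> frob_fix N \<Longrightarrow> poly f x \<in> frob_fix N"
  shows "char_sum N f = 2 * int (card {x \<in> frob_fix N. \<exists>y\<in>frob_fix N. y^2 + y = poly f x}) - 2 ^ N"
proof -
  define S where "S = {x \<in> frob_fix N. \<exists>y\<in>frob_fix N. y^2 + y = poly f x}"
  have fin: "finite (frob_fix N)" using N by (rule finite_frob_fix)
  have "char_sum N f = (\<Sum>x\<in>frob_fix N. (if x \<in> S then 2 else 0) - 1)"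
    unfolding char_sum_def using f by (intro sum.cong) (auto simp: psi_eq_artin_schreier S_def)
  also have "\<dots> = 2 * int (card (frob_fix N \<inter> S)) - 2 ^ N"
    using fin by (simp add: sum_subtractf card_frob_fix N sum.If_cases)
  also have "frob_fix N \<inter> S = S" by (auto simp: S_def)
  finally show ?thesis by (simp add: S_def)
qed

text \<open>Counting points gives an upper bound only. Adding a constant of trace 1 to f negates the
  character sum, so the upper bound for f + c is the lower bound for f.\<close>

lemma abs_char_sum_le:
  assumes f: "\<And>x. x \<in> frob_fix (2 * h) \<Longrightarrow> poly f x \<in> frob_fix (2 * h)"
    and d: "degree f = 2 * g + 1" and h: "h > 0" "(2 * g + 1) * (g + 1) < 2 ^ h"
  shows "\<bar>char_sum (2 * h) f\<bar> \<le> 2 * int (degree f) * 2 ^ h"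
proof -
  let ?N = "2 * h"
  have upper: "char_sum ?N f' \<le> 2 * int (2 * g + 1) * 2 ^ h"
    if "\<And>x. x \<in> frob_fix ?N \<Longrightarrow> poly f' x \<in> frob_fix ?N" "degree f' = 2 * g + 1" for f'
  proof -
    have "int (2 * card {x \<in> frob_fix ?N. \<exists>y\<in>frob_fix ?N. y^2 + y = poly f' x})
        \<le> int (2 ^ ?N + 2 * degree f' * 2 ^ h)"
      using card_artin_schreier_le[OF that(2) h] by (simp only: of_nat_le_iff)
    then show ?thesis
      using char_sum_eq_card[OF _ that(1)] h(1) by (simp add: that(2) algebra_simps)
  qed
  obtain c where c: "c \<in> frob_fix ?N" "tr ?N c \<noteq> 0"
    using ex_tr_ne_zero[OF _ finite_frob_fix(1) card_frob_fix, of ?N] h(1) by auto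
  have "degree (f + [:c:]) = degree f"
    using d by (intro degree_add_eq_left) simp
  then have "char_sum ?N (f + [:c:]) \<le> 2 * int (2 * g + 1) * 2 ^ h"
    using c f by (intro upper) (auto intro: frob_fix_add simp: d)
  moreover have "char_sum ?N (f + [:c:]) = - char_sum ?N f"
    using c f unfolding char_sum_def sum_negf[symmetric]
    by (intro sum.cong) (simp_all add: psi_add, simp add: psi_def)
  ultimately show ?thesis
    using upper[OF f d] by (simp add: d)
qed

theorem weil_bound:
  assumes m: "m > 0" and f: "\<And>i. coeff f i \<in> frob_fix m" and d: "odd (degree f)"
  shows "\<bar>real_of_int (char_sum m f)\<bar> \<le> (real (degree f) - 1) * sqrt (2 ^ m)"
proof -
  obtain g where g: "degree f = 2 * g + 1" using d by (auto elim: oddE)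
  define A where "A = L_coeff m f"
  have "frob_mset m 0 = {{#}}" by (auto simp: frob_mset_def)
  then have A0: "A 0 = 1" by (simp add: A_def L_coeff_def chi_def)
  define L where "L = Abs_poly (\<lambda>n. of_int (A n) :: complex)"
  have A_ge: "A n = 0" if "n > 2 * g" for n
    using L_coeff_eq_0[OF m f d, of n] that by (simp add: A_def g)
  then have cL: "coeff L n = of_int (A n)" for n
    unfolding L_def by (subst coeff_Abs_poly) auto
  have degL: "degree L \<le> 2 * g"
    by (rule degree_le) (auto simp: cL A_ge)
  \<comment> \<open>The inverse roots of L: its constant coefficient is 1, so the reversed
    polynomial is monic.\<close>
  define W where "W = proots (reflect_poly L)"
  have L0: "coeff L 0 = 1" by (simp add: cL A0)
  then have "lead_coeff (reflect_poly L) = 1"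
    by (simp add: coeff_reflect_poly degree_reflect_poly_eq)
  note W = poly_eq_prod_mset_proots[OF this, folded W_def]
  have sizeW: "size W \<le> 2 * g"
    using W(2) degL degree_reflect_poly_le[of L] by simp
  have rr: "reflect_poly (\<Prod>x\<in>#W. [:-x, 1:]) = L"
    unfolding W(1)[symmetric] using L0 by simp
  have S: "of_int (char_sum (m * k) f) = - (\<Sum>z\<in>#W. z ^ k)" if "k > 0" for k
    using that
  proof (induction k rule: less_induct)
    case (less k)
    have "of_int (int k * A k) = (of_int (\<Sum>i = 1..k. char_sum (m * i) f * A (k - i)) :: complex)"
      unfolding A_def by (subst L_coeff_recursion[OF m f]) simp
    also have "\<dots> = (\<Sum>i = 1..k. of_int (A (k - i)) * of_int (char_sum (m * i) f))"
      by (simp add: mult.commute)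
    also have "{1..k} = insert k {1..<k}" using less.prems by auto
    also have "(\<Sum>i\<in>insert k {1..<k}. of_int (A (k - i)) * of_int (char_sum (m * i) f))
        = of_int (char_sum (m * k) f) + (\<Sum>i=1..<k. of_int (A (k - i)) * (of_int (char_sum (m * i) f) :: complex))"
      by (simp add: A0)
    also have "(\<Sum>i=1..<k. of_int (A (k - i)) * (of_int (char_sum (m * i) f) :: complex))
        = (\<Sum>i=1..<k. of_int (A (k - i)) * (- (\<Sum>z\<in>#W. z ^ i)))"
      using less.IH by (intro sum.cong) auto
    also have "\<dots> = (\<Sum>i=1..<k. of_int (A i) * (- (\<Sum>z\<in>#W. z ^ (k - i))))"
      by (rule sum.reindex_bij_witness[of _ "\<lambda>i. k - i" "\<lambda>i. k - i"]) auto
    also have "\<dots> = - (\<Sum>i=1..<k. coeff L i * (\<Sum>z\<in>#W. z ^ (k - i)))"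
      by (simp add: cL sum_negf del: sum_mset_distrib_left)
    finally have "of_int (char_sum (m * k) f) = of_nat k * coeff L k + (\<Sum>i=1..<k. coeff L i * (\<Sum>z\<in>#W. z ^ (k - i)))"
      by (simp add: cL)
    then show ?case
      using newton_identity[OF less.prems, of W] unfolding rr by simp
  qed
  have norm_le: "norm w \<le> sqrt (2 ^ m)" if "w \<in># W" for w
  proof -
    have "norm (w^2) \<le> 2 ^ m"
    \<comment> \<open>Point counts are available in even degree only, so the squares of the inverse
      roots are used: their k-th power sum belongs to degree 2*m*k. The threshold for k meets the
      size condition of the count because k < 2^k.\<close>
    proof (rule norm_le_of_power_sums_le[of "2 ^ m" "w^2" "image_mset (\<lambda>z. z^2) W" "(2 * g + 1) * (g + 1)" "2 * (2 * real g + 1)"])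
      fix k assume k: "(2 * g + 1) * (g + 1) \<le> k"
      then have k0: "k > 0" by (simp add: add_pos_nonneg)
      have "(2 * g + 1) * (g + 1) < 2 ^ (m * k)"
      proof -
        have "k < 2 ^ k" by (rule less_exp)
        also have "\<dots> \<le> 2 ^ (m * k)" using m by (intro power_increasing) auto
        finally show ?thesis using k by simp
      qed
      moreover have "poly f x \<in> frob_fix (2 * (m * k))" if "x \<in> frob_fix (2 * (m * k))" for x
        using that frob_fix_dvd[OF f, of _ "2 * k"] by (intro frob_fix_poly) (auto simp: mult_ac)
      ultimately have "\<bar>char_sum (2 * (m * k)) f\<bar> \<le> 2 * int (degree f) * 2 ^ (m * k)"
        using m k0 by (intro abs_char_sum_le[OF _ g]) auto
      then have "\<bar>real_of_int (char_sum (m * (2 * k)) f)\<bar> \<le> real_of_int (2 * int (degree f) * 2 ^ (m * k))"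
        by (simp only: of_int_le_iff flip: of_int_abs) (simp add: mult_ac)
      moreover have "(\<Sum>z\<in>#image_mset (\<lambda>z. z^2) W. z ^ k) = - of_int (char_sum (m * (2 * k)) f)"
        using S[of "2 * k"] k0 by (simp add: image_mset.compositionality o_def flip: power_mult)
      ultimately show "norm (\<Sum>z\<in>#image_mset (\<lambda>z. z^2) W. z ^ k) \<le> 2 * (2 * real g + 1) * (2 ^ m) ^ k"
        by (simp add: g power_mult) (simp add: algebra_simps)
    qed (use that in auto)
    then have "norm w ^ 2 \<le> 2 ^ m" by (simp add: norm_power)
    then show ?thesis by (simp add: real_le_rsqrt)
  qed
  have "norm (\<Sum>z\<in>#V. z) \<le> real (size V) * sqrt (2 ^ m)" if "V \<subseteq># W" for V
    using that
  proof (induction V)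
    case (add v V)
    then have "norm v \<le> sqrt (2 ^ m)" "norm (\<Sum>z\<in>#V. z) \<le> real (size V) * sqrt (2 ^ m)"
      using norm_le by (auto simp: insert_subset_eq_iff dest: mset_subset_eqD intro: subset_mset.trans)
        (meson diff_subset_eq_self subset_mset.order_trans)
    then show ?case
      using norm_triangle_ineq[of v "\<Sum>z\<in>#V. z"] by (simp add: algebra_simps)
  qed simp
  from this[of W] have "\<bar>real_of_int (char_sum m f)\<bar> \<le> real (size W) * sqrt (2 ^ m)"
    using arg_cong[OF S[of 1], of norm] by simp
  also have "\<dots> \<le> real (2 * g) * sqrt (2 ^ m)"
    using sizeW by (intro mult_right_mono) auto
  finally show ?thesis by (simp add: g)
qed

end
section \<open>Finite fields of even order\<close>

lemma CHAR_eq_2_of_CARD: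
  assumes "CARD('a::{field,finite}) = 2 ^ m" shows "CHAR('a) = 2"
proof -
  have "(\<Sum>x\<in>(UNIV::'a set). x) = (\<Sum>x\<in>UNIV. x + 1)"
    by (rule sum.reindex_bij_witness[of _ "\<lambda>x. x + 1" "\<lambda>x. x - 1"]) auto
  then have "of_nat (CARD('a)) = (0::'a)"
    by (simp add: sum.distrib)
  then have "CHAR('a) dvd 2 ^ m"
    using assms of_nat_eq_0_iff_char_dvd by metis
  moreover from this have "CHAR('a) > 0"
    by (auto intro: Nat.gr0I)
  then have "prime CHAR('a)"
    by (rule prime_CHAR_semidom)
  ultimately show ?thesis
    by (metis prime_dvd_power primes_dvd_imp_eq two_is_prime_nat)
qed

text \<open>Regularity of a Vandermonde system, shown with the polynomial that vanishes at all nodes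
  but one. It yields both the BCH bound and the distinctness of the trace words.\<close>

lemma exp_sum_coeffs_eq_0:
  fixes \<beta> w :: "'i \<Rightarrow> 'a::field"
  assumes fin: "finite S" and inj: "inj_on \<beta> S"
    and zero: "\<And>k. k < card S \<Longrightarrow> (\<Sum>s\<in>S. w s * \<beta> s ^ k) = 0" and t: "t \<in> S"
  shows "w t = 0"
proof -
  define p where "p = (\<Prod>s\<in>S - {t}. [:- \<beta> s, 1:])"
  have "degree p \<le> (\<Sum>s\<in>S - {t}. degree [:- \<beta> s, 1:])"
    unfolding p_def using fin by (intro degree_prod_sum_le[unfolded o_def]) simp
  also have "\<dots> < card S"
    using fin t by (simp add: card_gt_0_iff card_Diff_singleton) (metis card_gt_0_iff empty_iff diff_Suc_less One_nat_def)
  finally have deg: "degree p < card S" .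
  have "0 = (\<Sum>k\<le>degree p. coeff p k * (\<Sum>s\<in>S. w s * \<beta> s ^ k))"
    using zero deg by simp
  also have "\<dots> = (\<Sum>s\<in>S. w s * poly p (\<beta> s))"
    unfolding poly_altdef sum_distrib_left by (subst sum.swap) (simp add: mult_ac)
  also have "\<dots> = (\<Sum>s\<in>S. if s = t then w t * poly p (\<beta> t) else 0)"
    using fin by (intro sum.cong) (auto simp: p_def poly_prod)
  also have "\<dots> = w t * poly p (\<beta> t)"
    using fin t by simp
  finally have "w t * poly p (\<beta> t) = 0" ..
  moreover have "poly p (\<beta> t) \<noteq> 0"
    using fin inj t by (auto simp: p_def poly_prod inj_on_def)
  ultimately show ?thesis by simp
qed

context char2
begin

lemma frob_fix_mod:
  assumes "x \<in> frob_fix a" "x \<in> frob_fix b" shows "x \<in> frob_fix (a mod b)"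
proof -
  have "x = x ^ 2 ^ (b * (a div b) + a mod b)"
    using assms(1) by (simp add: frob_fix_def)
  also have "\<dots> = (x ^ 2 ^ (b * (a div b))) ^ 2 ^ (a mod b)"
    unfolding power_add power_mult ..
  also have "x ^ 2 ^ (b * (a div b)) = x"
    using frob_fix_dvd[OF assms(2)] by (simp add: frob_fix_def)
  finally show ?thesis by (simp add: frob_fix_def)
qed

lemma frob_fix_gcd: "x \<in> frob_fix a \<Longrightarrow> x \<in> frob_fix b \<Longrightarrow> x \<in> frob_fix (gcd a b)"
proof (induction a b rule: gcd_nat_induct)
  case (step a b)
  then show ?case using frob_fix_mod by (metis gcd_red_nat)
qed simp

lemma sum_symmetric_difference:
  fixes f :: "'b \<Rightarrow> 'k"
  assumes "finite A" "finite B"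
  shows "sum f ((A - B) \<union> (B - A)) = sum f A + sum f B"
proof -
  have "sum f A = sum f (A - B) + sum f (A \<inter> B)" "sum f B = sum f (B - A) + sum f (A \<inter> B)"
    using assms by (subst sum.union_disjoint[symmetric]; auto intro: arg_cong[of _ _ "sum f"])+
  moreover have "sum f ((A - B) \<union> (B - A)) = sum f (A - B) + sum f (B - A)"
    using assms by (intro sum.union_disjoint) auto
  ultimately show ?thesis by (simp add: add_ac)
qed

end

theorem weil_bound_finite_field:
  fixes f :: "'a::{field,finite} poly"
  assumes card: "CARD('a) = 2 ^ m" and m: "m > 0" and d: "odd (degree f)"
  shows "\<bar>real_of_int (\<Sum>x\<in>UNIV. char2.psi m (poly f x))\<bar> \<le> (real (degree f) - 1) * sqrt (2 ^ m)"
proof -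
  have char: "CHAR('a) = 2" using card by (rule CHAR_eq_2_of_CARD)
  interpret A: char2 "TYPE('a)" by unfold_locales (rule char)
  interpret C: closed_char2 "TYPE('a alg_closure)" by unfold_locales (simp add: char)
  have all: "x ^ 2 ^ m = x" for x :: 'a
  proof (cases "x = 0")
    case False
    have "(\<Prod>y\<in>UNIV - {0}. y) = (\<Prod>y\<in>UNIV - {0}. x * y)"
      using False by (intro prod.reindex_bij_witness[of _ "\<lambda>y. x * y" "\<lambda>y. y / x"]) auto
    then have "(\<Prod>y\<in>UNIV - {0}. y) = x ^ (CARD('a) - 1) * (\<Prod>y\<in>UNIV - {0}. y)"
      by (simp add: prod.distrib card_Diff_singleton)
    moreover have "(\<Prod>y\<in>UNIV - {0::'a}. y) \<noteq> 0" by simp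
    ultimately have "x ^ (2 ^ m - 1) = 1" by (simp add: card)
    then have "x ^ Suc (2 ^ m - 1) = x" by (simp only: power_Suc mult_1_right)
    then show ?thesis by (simp only: Suc_diff_1 zero_less_power zero_less_numeral)
  qed simp
  have sub: "range to_ac \<subseteq> (C.frob_fix m :: 'a alg_closure set)"
    using all by (auto simp: C.frob_fix_def simp flip: to_ac_power)
  \<comment> \<open>An inclusion between sets of the same size 2^m, so the embedded field is exactly
    the fixed set.\<close>
  then have range: "range to_ac = (C.frob_fix m :: 'a alg_closure set)"
    using C.finite_frob_fix(1)[OF m] C.card_frob_fix[OF m]
    by (intro card_subset_eq) (auto simp: card_image[OF inj_to_ac] card)
  define F where "F = map_poly to_ac f"
  have F: "coeff F i = to_ac (coeff f i)" for i by (simp add: F_def coeff_map_poly)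
  have degF: "degree F = degree f" unfolding F_def by (rule degree_map_poly) simp
  have polyF: "poly F (to_ac x) = to_ac (poly f x)" for x
    unfolding poly_altdef degF F by (simp add: to_ac_sum)
  have tr: "C.tr m (to_ac z) = to_ac (A.tr m z)" for z
    by (simp add: C.tr_def A.tr_def to_ac_sum)
  have psi: "C.psi m (to_ac z) = A.psi m z" for z
    by (simp add: C.psi_def A.psi_def tr)
  have "C.char_sum m F = (\<Sum>x\<in>UNIV. A.psi m (poly f x))"
    unfolding C.char_sum_def range[symmetric] by (subst sum.reindex[OF inj_to_ac]) (simp add: polyF psi)
  moreover have "\<bar>real_of_int (C.char_sum m F)\<bar> \<le> (real (degree F) - 1) * sqrt (2 ^ m)"
    using sub d by (intro C.weil_bound m) (auto simp: F degF)
  ultimately show ?thesis by (simp add: degF)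
qed

section \<open>The dual of a primitive BCH code\<close>

locale bch = char2 K for K :: "'k::{field,finite} itself" +
  fixes m n e :: nat and \<theta> :: 'k
  assumes m: "m > 0" and card_field: "CARD('k) = 2 ^ m" and n_def: "n = 2 ^ m - 1"
    and primitive: "primitive_element \<theta>" and e: "e > 0"
begin

lemma n_pos: "n > 0"
  using m one_less_power[of "2::nat" m] by (simp add: n_def)

lemma theta_pow_n: "\<theta> ^ n = 1" and theta_pow_ne_1: "0 < k \<Longrightarrow> k < n \<Longrightarrow> \<theta> ^ k \<noteq> 1"
  using primitive by (auto simp: primitive_element_def card_field n_def)

lemma theta_ne_0: "\<theta> \<noteq> 0"
  using theta_pow_n n_pos by (auto simp: power_0_left)

lemma theta_pow_eq_1_iff: "\<theta> ^ k = 1 \<longleftrightarrow> n dvd k"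
proof -
  have "\<theta> ^ k = (\<theta> ^ n) ^ (k div n) * \<theta> ^ (k mod n)"
    by (simp flip: power_mult power_add)
  then have "\<theta> ^ k = \<theta> ^ (k mod n)"
    by (simp add: theta_pow_n)
  moreover have "\<theta> ^ (k mod n) = 1 \<longleftrightarrow> k mod n = 0"
    using theta_pow_ne_1[of "k mod n"] n_pos by (cases "k mod n = 0") auto
  ultimately show ?thesis
    by (simp add: mod_eq_0_iff_dvd)
qed

lemma theta_pow_inj: "inj_on (\<lambda>i. \<theta> ^ i) {..<n}"
proof (rule inj_onI)
  have *: "i = j" if "i \<le> j" "j < n" "\<theta> ^ i = \<theta> ^ j" for i j
  proof -
    have "\<theta> ^ j = \<theta> ^ i * \<theta> ^ (j - i)" using that(1) by (metis le_add_diff_inverse power_add)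
    then have "\<theta> ^ (j - i) = 1" using that(3) theta_ne_0 by simp
    then show ?thesis using theta_pow_ne_1[of "j - i"] that by (cases "j - i = 0") auto
  qed
  fix i j assume "i \<in> {..<n}" "j \<in> {..<n}" "\<theta> ^ i = \<theta> ^ j"
  then show "i = j" using *[of i j] *[of j i] by (cases "i \<le> j") auto
qed

lemma theta_pow_image: "(\<lambda>i. \<theta> ^ i) ` {..<n} = UNIV - {0}"
proof (rule card_subset_eq)
  show "card ((\<lambda>i. \<theta> ^ i) ` {..<n}) = card (UNIV - {0::'k})"
    unfolding card_image[OF theta_pow_inj] by (simp add: card_Diff_singleton card_field n_def)
qed (auto simp: theta_ne_0)

lemma frob_m [simp]: "(x::'k) ^ 2 ^ m = x"
proof (cases "x = 0")
  case False
  then obtain i where "x = \<theta> ^ i" using theta_pow_image by (metis DiffI UNIV_I imageE singletonD)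
  then have "x ^ n = 1" by (metis mult.commute power_mult power_one theta_pow_n)
  moreover have "2 ^ m = Suc n" by (simp add: n_def)
  ultimately show ?thesis by simp
qed simp

lemma frob_fix_m [simp]: "x \<in> frob_fix m"
  by (simp add: frob_fix_def)

definition power_sum :: "'k set \<Rightarrow> nat \<Rightarrow> 'k" where
  "power_sum U k = (\<Sum>x\<in>U. x ^ k)"

lemma power_sum_eq_0_all:
  assumes "\<And>j. j \<in> {1..e} \<Longrightarrow> power_sum U (2 * j - 1) = 0" and "1 \<le> k" "k \<le> 2 * e"
  shows "power_sum U k = 0"
  using assms(2,3)
proof (induction k rule: less_induct)
  case (less k)
  show ?case
  proof (cases "even k")
    case True
    then obtain l where l: "k = l * 2" by (auto elim: evenE)
    have "power_sum U k = power_sum U l ^ 2 ^ 1"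
      unfolding power_sum_def frob_sum by (simp add: l power_mult)
    also have "power_sum U l = 0" using less l by auto
    finally show ?thesis by simp
  next
    case False
    then obtain l where "k = 2 * l + 1" by (auto elim: oddE)
    then show ?thesis using assms(1)[of "l + 1"] less.prems by simp
  qed
qed

text \<open>Otherwise, by squaring, the power sums vanish for all exponents from 1 to 2*e. The
  exponents start at 1, so each node x also serves as its own weight in the Vandermonde system,
  which then forces x = 0.\<close>

lemma bch_bound:
  assumes U: "0 \<notin> U" "U \<noteq> {}" "card U \<le> 2 * e"
  shows "\<exists>j\<in>{1..e}. power_sum U (2 * j - 1) \<noteq> 0"
proof (rule ccontr)
  assume "\<not> ?thesis"
  then have "power_sum U k = 0" if "1 \<le> k" "k \<le> 2 * e" for k
    using power_sum_eq_0_all that by blast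
  then have "(\<Sum>x\<in>U. x * x ^ k) = 0" if "k < card U" for k
    using that U(3) unfolding power_sum_def by (metis (no_types, lifting) Suc_leI le_add1 order_less_le_trans plus_1_eq_Suc power_Suc sum.cong)
  moreover obtain x where "x \<in> U" using U(2) by blast
  ultimately have "x = 0"
    using exp_sum_coeffs_eq_0[of U "\<lambda>x. x" "\<lambda>x. x" x] by simp
  with U(1) \<open>x \<in> U\<close> show False by simp
qed

text \<open>The syndrome of the word with support U, coordinates being named by field elements.
  Restricting it to {1..e} places it in a finite function space, as counting requires.\<close>

definition syndrome :: "'k set \<Rightarrow> nat \<Rightarrow> 'k" where
  "syndrome U = (\<lambda>j\<in>{1..e}. power_sum U (2 * j - 1))"

definition small_sets :: "nat \<Rightarrow> 'k set set" where
  "small_sets r = {U. U \<subseteq> UNIV - {0} \<and> card U \<le> r}"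

lemma card_small_sets: "card (small_sets r) = (\<Sum>i=0..r. n choose i)"
proof -
  have "small_sets r = (\<Union>i\<in>{0..r}. {U. U \<subseteq> UNIV - {0} \<and> card U = i})"
    by (auto simp: small_sets_def)
  also have "card \<dots> = (\<Sum>i\<in>{0..r}. card {U. U \<subseteq> UNIV - {0::'k} \<and> card U = i})"
    by (intro card_UN_disjoint) auto
  also have "\<dots> = (\<Sum>i=0..r. n choose i)"
    by (subst n_subsets) (simp_all add: card_Diff_singleton card_field n_def)
  finally show ?thesis .
qed

text \<open>Two sets with equal syndromes would have a symmetric difference of at most 2*e points
  against \<open>bch_bound\<close>. This is the packing of Hamming balls of radius e.\<close>

lemma inj_on_syndrome: "inj_on syndrome (small_sets e)"
proof (rule inj_onI, rule ccontr)
  fix U V assume *: "U \<in> small_sets e" "V \<in> small_sets e" "syndrome U = syndrome V" "U \<noteq> V"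
  define Z where "Z = (U - V) \<union> (V - U)"
  have "card Z \<le> card (U - V) + card (V - U)" unfolding Z_def by (rule card_Un_le)
  also have "\<dots> \<le> card U + card V" by (intro add_mono card_mono) auto
  also have "\<dots> \<le> 2 * e" using * by (auto simp: small_sets_def)
  finally have "card Z \<le> 2 * e" .
  moreover have "Z \<noteq> {}" using *(4) by (auto simp: Z_def)
  moreover have "0 \<notin> Z" using *(1,2) by (auto simp: Z_def small_sets_def)
  ultimately obtain j where j: "j \<in> {1..e}" "power_sum Z (2 * j - 1) \<noteq> 0"
    using bch_bound[of Z] by blast
  have "power_sum Z (2 * j - 1) = power_sum U (2 * j - 1) + power_sum V (2 * j - 1)"
    unfolding power_sum_def Z_def by (rule sum_symmetric_difference) auto
  also have "\<dots> = 0"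
    using fun_cong[OF *(3), of j] j(1) by (simp add: syndrome_def add_eq_zero_iff)
  finally show False using j(2) by simp
qed

end
no_notation fps_nth (infixl "$" 75)

lemma choose_Suc_le: "n choose Suc i \<le> n * (n choose i)"
proof (induction n)
  case (Suc n)
  have "Suc n choose Suc i \<le> (n choose i) + n * (n choose i)"
    using Suc by simp
  also have "\<dots> = Suc n * (n choose i)" by simp
  also have "\<dots> \<le> Suc n * (Suc n choose i)"
    by (intro mult_le_mono2) (cases i; simp)
  finally show ?case .
qed simp

text \<open>Brings (P2) from e + 1 down to e, the radius of the Hamming bound, at the cost of the
  factor \<open>Suc n\<close>, which will be 2^m.\<close>

lemma sum_choose_Suc_le: "(\<Sum>i=0..Suc e. n choose i) \<le> Suc n * (\<Sum>i=0..e. n choose i)"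
proof -
  have "(\<Sum>i=0..Suc e. n choose i) = 1 + (\<Sum>i=0..e. n choose Suc i)"
    unfolding sum.atLeast0_atMost_Suc_shift by simp
  also have "\<dots> \<le> (\<Sum>i=0..e. n choose i) + (\<Sum>i=0..e. n * (n choose i))"
  proof (intro add_mono sum_mono choose_Suc_le)
    show "1 \<le> (\<Sum>i=0..e. n choose i)"
      using member_le_sum[of 0 "{0..e}" "\<lambda>i. n choose i"] by simp
  qed
  also have "\<dots> = Suc n * (\<Sum>i=0..e. n choose i)"
    by (simp only: sum_distrib_left[symmetric] mult_Suc)
  finally show ?thesis .
qed

lemma UNIV_bit: "UNIV = {0, 1 :: bit}"
  using bit_not_zero_iff by blast

lemma card_UNIV_bit: "finite (UNIV :: bit set)" "card (UNIV :: bit set) = 2"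
  by (simp_all add: UNIV_bit)

section \<open>Evaluation of binary polynomials in the extension field\<close>

context char2
begin

lemma of_bit_add: "(of_bit (a + b) :: 'k) = of_bit a + of_bit b"
  by (cases a; cases b) auto

lemma of_bit_mult: "(of_bit (a * b) :: 'k) = of_bit a * of_bit b"
  by (cases a; cases b) auto

lemma of_bit_sum: "(of_bit (\<Sum>i\<in>A. f i :: bit) :: 'k) = (\<Sum>i\<in>A. of_bit (f i))"
proof (induction A rule: infinite_finite_induct)
  case (insert x F)
  have "(of_bit (sum f (insert x F)) :: 'k) = of_bit (f x + sum f F)"
    by (subst sum.insert[OF insert(1,2)]) (rule refl)
  also have "\<dots> = of_bit (f x) + of_bit (sum f F)"
    by (rule of_bit_add)
  also have "\<dots> = (\<Sum>i\<in>insert x F. of_bit (f i))"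
    unfolding insert(3) by (rule sum.insert[OF insert(1,2), symmetric])
  finally show ?case .
qed simp_all

definition eval_bit :: "bit poly \<Rightarrow> 'k \<Rightarrow> 'k" where
  "eval_bit p \<alpha> = poly (map_poly of_bit p) \<alpha>"

lemma coeff_map_of_bit: "coeff (map_poly of_bit p :: 'k poly) i = of_bit (coeff p i)"
  by (rule coeff_map_poly) simp

lemma eval_bit_add: "eval_bit (p + r) \<alpha> = eval_bit p \<alpha> + eval_bit r \<alpha>"
proof -
  have "map_poly of_bit (p + r) = (map_poly of_bit p + map_poly of_bit r :: 'k poly)"
    by (rule poly_eqI) (simp only: coeff_map_of_bit coeff_add of_bit_add)
  then show ?thesis by (simp add: eval_bit_def)
qed

lemma eval_bit_mult: "eval_bit (p * r) \<alpha> = eval_bit p \<alpha> * eval_bit r \<alpha>"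
proof -
  have "map_poly of_bit (p * r) = (map_poly of_bit p * map_poly of_bit r :: 'k poly)"
    by (rule poly_eqI) (simp only: coeff_map_of_bit coeff_mult of_bit_mult of_bit_sum)
  then show ?thesis by (simp add: eval_bit_def)
qed

lemma eval_bit_1 [simp]: "eval_bit 1 \<alpha> = 1"
  by (simp add: eval_bit_def map_poly_1')

lemma eval_bit_monom: "eval_bit (monom 1 k) \<alpha> = \<alpha> ^ k"
  by (simp add: eval_bit_def map_poly_monom poly_monom)

lemma eval_bit_prod_eq_0:
  assumes "finite A" "j \<in> A" "eval_bit (p j) \<alpha> = 0" shows "eval_bit (\<Prod>i\<in>A. p i) \<alpha> = 0"
  using assms by (simp add: prod.remove eval_bit_mult)

lemma eval_bit_eq_sum:
  assumes "degree p < N" shows "eval_bit p \<alpha> = (\<Sum>i=0..<N. of_bit (coeff p i) * \<alpha> ^ i)"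
proof -
  have "eval_bit p \<alpha> = (\<Sum>i\<le>degree (map_poly of_bit p :: 'k poly). of_bit (coeff p i) * \<alpha> ^ i)"
    by (simp only: eval_bit_def poly_altdef coeff_map_of_bit)
  also have "\<dots> = (\<Sum>i=0..<N. of_bit (coeff p i) * \<alpha> ^ i)"
  proof (rule sum.mono_neutral_left)
    show "{..degree (map_poly of_bit p :: 'k poly)} \<subseteq> {0..<N}"
      using assms order.strict_trans1[OF degree_le[of "degree p" "map_poly of_bit p :: 'k poly"] assms]
      by (auto simp only: coeff_map_of_bit) (auto simp: coeff_eq_0)
    show "\<forall>i\<in>{0..<N} - {..degree (map_poly of_bit p :: 'k poly)}. of_bit (coeff p i) * \<alpha> ^ i = 0"
      using coeff_map_of_bit[of p] by (metis DiffE atMost_iff coeff_eq_0 mult_zero_left not_le)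
  qed simp
  finally show ?thesis .
qed

end

section \<open>The generator polynomial, the dual code and its trace words\<close>

context bch
begin

lemma is_minimal_poly_minimal_poly: "is_minimal_poly (minimal_poly \<alpha>) (\<alpha>::'k)"
  unfolding minimal_poly_def by (rule theI', rule ex1_minimal_poly, rule two_eq_zero)

lemma eval_bit_minimal_poly: "eval_bit (minimal_poly \<alpha>) \<alpha> = 0"
  using is_minimal_poly_minimal_poly by (simp add: is_minimal_poly_def eval_bit_def)

text \<open>Pigeonhole: there are 2^(m+1) binary polynomials of degree at most m but only 2^m values
  at \<alpha>, and the difference of two polynomials with the same value has the root
  \<alpha>.\<close>

lemma degree_minimal_poly_le: "degree (minimal_poly (\<alpha>::'k)) \<le> m"
proof -
  define V where "V xs = (eval_bit (Poly xs) \<alpha>)" for xs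
  define S where "S = {xs :: bit list. set xs \<subseteq> UNIV \<and> length xs = m + 1}"
  have "card S = 2 ^ (m + 1)"
    unfolding S_def by (subst card_lists_length_eq) (simp_all only: card_UNIV_bit)
  then have "\<not> inj_on V S"
    using card_inj_on_le[of V S UNIV] by (auto simp: card_field)
  then obtain xs ys where xy: "xs \<in> S" "ys \<in> S" "xs \<noteq> ys" "V xs = V ys"
    by (auto simp: inj_on_def)
  define q where "q = Poly xs + Poly ys"
  have "q \<noteq> 0"
  proof
    assume "q = 0"
    have "coeff (Poly xs) i + coeff (Poly ys) i = 0" for i
      using \<open>q = 0\<close> unfolding q_def by (metis coeff_0 coeff_add)
    moreover have "x + y = 0 \<Longrightarrow> x = y" for x y :: bit
      by (cases x; cases y) auto
    ultimately have "nth_default 0 xs i = nth_default 0 ys i" for i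
      by (metis coeff_Poly_eq)
    then show False
      using xy by (auto simp: S_def intro!: nth_equalityI) (metis nth_default_nth nth_equalityI)
  qed
  moreover have "eval_bit q \<alpha> = 0"
    using xy by (simp add: q_def eval_bit_add V_def)
  ultimately have "degree (minimal_poly \<alpha>) \<le> degree q"
    using is_minimal_poly_minimal_poly[of \<alpha>] by (auto simp: is_minimal_poly_def eval_bit_def)
  also have "degree q \<le> m"
    using xy unfolding q_def S_def
    by (intro degree_add_le) (auto intro!: degree_le simp: coeff_Poly_eq nth_default_beyond)
  finally show ?thesis .
qed

definition g :: "bit poly" where
  "g = (\<Prod>j = 1..e. minimal_poly (\<theta> ^ (2 * j - 1)))"

definition \<O> :: "bit vec set" where
  "\<O> = dual_code n (cyclic_code n g)"

lemma lead_coeff_g: "lead_coeff g = 1"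
  using is_minimal_poly_minimal_poly unfolding g_def
  by (subst lead_coeff_prod) (intro prod.neutral, auto simp: is_minimal_poly_def)

lemma degree_g_le: "degree g \<le> m * e"
proof -
  have "degree g \<le> (\<Sum>j=1..e. degree (minimal_poly (\<theta> ^ (2 * j - 1))))"
    unfolding g_def by (rule degree_prod_sum_le[unfolded o_def]) simp
  also have "\<dots> \<le> (\<Sum>j=1..e. m)"
    by (intro sum_mono degree_minimal_poly_le)
  finally show ?thesis by (simp add: mult.commute)
qed

lemma eval_bit_codeword:
  assumes "c \<in> cyclic_code n g" "j \<in> {1..e}"
  shows "(\<Sum>i=0..<n. of_bit (c $ i) * \<theta> ^ (i * (2 * j - 1))) = 0"
proof -
  obtain p q where p: "c = vec n (coeff p)" "degree p < n" "[p = q * g] (mod (monom 1 n - 1))"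
    using assms(1) by (auto simp: cyclic_code_def)
  then obtain k where "p - q * g = (monom 1 n - 1) * k"
    unfolding cong_iff_dvd_diff by (elim dvdE)
  then have "p = q * g + (monom 1 n - 1) * k"
    by (metis add.commute diff_add_cancel)
  also have "monom 1 n - 1 = monom 1 n + (1 :: bit poly)"
    by (rule poly_eqI) (simp only: coeff_diff coeff_add minus_bit_def)
  finally have pe: "p = q * g + (monom 1 n + 1) * k" .
  define \<alpha> where "\<alpha> = \<theta> ^ (2 * j - 1)"
  have "\<alpha> ^ n = 1"
    by (metis \<alpha>_def mult.commute power_mult power_one theta_pow_n)
  moreover have "eval_bit g \<alpha> = 0"
    unfolding g_def using assms(2) by (intro eval_bit_prod_eq_0[of _ j]) (auto simp: \<alpha>_def eval_bit_minimal_poly simp del: One_nat_def)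
  ultimately have "eval_bit p \<alpha> = 0"
    unfolding pe by (simp add: eval_bit_add eval_bit_mult eval_bit_monom)
  then show ?thesis
    using p(1,2) by (simp add: eval_bit_eq_sum \<alpha>_def mult.commute flip: power_mult)
qed

text \<open>For k >= D the shift X^(k-D) * g is a codeword with last nonzero coefficient 1 at
  position k. Orthogonality to it expresses coordinate k of a dual word through the earlier ones, so
  the first D coordinates determine the word.\<close>

lemma finite_dual: "finite \<O>" and card_dual_le: "card \<O> \<le> 2 ^ degree g"
proof -
  define D where "D = degree g"
  define R where "R v = (\<lambda>i\<in>{..<D}. v $ i)" for v :: "bit vec"
  have inj: "inj_on R \<O>"
  proof (rule inj_onI)
    fix v w assume vw: "v \<in> \<O>" "w \<in> \<O>" "R v = R w"
    then have dim: "dim_vec v = n" "dim_vec w = n" by (auto simp: \<O>_def dual_code_def)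
    have "v $ k = w $ k" if "k < n" for k
      using that
    proof (induction k rule: less_induct)
      case (less k)
      show ?case
      proof (cases "k < D")
        case True
        then show ?thesis using fun_cong[OF vw(3), of k] by (simp add: R_def)
      next
        case False
        define p where "p = monom 1 (k - D) * g"
        have g0: "g \<noteq> 0" using lead_coeff_g by auto
        have degp: "degree p = k"
          using False g0 by (simp add: p_def degree_mult_eq degree_monom_eq D_def)
        have lead: "coeff p k = 1"
          using lead_coeff_g by (simp only: degp[symmetric]) (simp only: p_def lead_coeff_mult lead_coeff_monom mult_1_left)
        have "vec n (coeff p) \<in> cyclic_code n g"
          unfolding cyclic_code_def mem_Collect_eq
          by (intro exI[of _ p] exI[of _ "monom 1 (k - D)"] conjI refl)
             (use degp less.prems in \<open>simp_all add: p_def\<close>)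
        then have 0: "vec n (coeff p) \<bullet> u = 0" if "u \<in> \<O>" for u
          using that unfolding \<O>_def dual_code_def by blast
        have "(\<Sum>i<k. coeff p i * u $ i) + u $ k = 0" if "u \<in> \<O>" "dim_vec u = n" for u
        proof -
          have "0 = (\<Sum>i=0..<n. coeff p i * u $ i)"
            using 0[OF that(1)] that(2) by (simp add: scalar_prod_def)
          also have "\<dots> = (\<Sum>i\<in>{..<Suc k}. coeff p i * u $ i)"
            using less.prems by (intro sum.mono_neutral_right) (auto simp: coeff_eq_0 degp)
          finally show ?thesis
            by (simp only: sum.lessThan_Suc lead mult_1_left)
        qed
        from this[OF vw(1) dim(1)] this[OF vw(2) dim(2)]
        have "(\<Sum>i<k. coeff p i * v $ i) + v $ k = (\<Sum>i<k. coeff p i * w $ i) + w $ k" by simp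
        moreover have "(\<Sum>i<k. coeff p i * v $ i) = (\<Sum>i<k. coeff p i * w $ i)"
          using less by (intro sum.cong) auto
        ultimately show ?thesis by (metis add_left_imp_eq)
      qed
    qed
    then show "v = w" using dim by (intro eq_vecI) auto
  qed
  have sub: "R ` \<O> \<subseteq> {..<D} \<rightarrow>\<^sub>E UNIV" by (auto simp: R_def split: if_splits)
  have finP: "finite ({..<D} \<rightarrow>\<^sub>E (UNIV :: bit set))" by (intro finite_PiE) (auto simp: card_UNIV_bit)
  show "finite \<O>"
    using inj_on_finite[OF inj sub finP] .
  have "card \<O> \<le> card ({..<D} \<rightarrow>\<^sub>E (UNIV :: bit set))"
    by (rule card_inj_on_le[OF inj sub finP])
  then show "card \<O> \<le> 2 ^ degree g"
    by (simp add: card_PiE card_UNIV_bit D_def)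
qed

definition trace_bit :: "'k \<Rightarrow> bit" where
  "trace_bit z = (if tr m z = 0 then 0 else 1)"

lemma trace_bit_0 [simp]: "trace_bit 0 = 0"
  by (simp add: trace_bit_def)

lemma trace_bit_add: "trace_bit (x + y) = trace_bit x + trace_bit y"
  using tr_cases[of x m] tr_cases[of y m] by (auto simp: trace_bit_def tr_add)

lemma trace_bit_sum: "trace_bit (\<Sum>i\<in>A. f i) = (\<Sum>i\<in>A. trace_bit (f i))"
proof (induction A rule: infinite_finite_induct)
  case (insert x F)
  then show ?case by (metis (no_types, lifting) trace_bit_add sum.insert)
qed simp_all

lemma trace_bit_of_bit_mult: "trace_bit (of_bit b * z) = b * trace_bit z"
  by (cases b) auto

definition trace_word :: "(nat \<Rightarrow> 'k) \<Rightarrow> bit vec" where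
  "trace_word a = vec n (\<lambda>i. trace_bit (\<Sum>j=1..e. a j * \<theta> ^ (i * (2 * j - 1))))"

lemma trace_word_in_dual: "trace_word a \<in> \<O>"
proof -
  have "c \<bullet> trace_word a = 0" if c: "c \<in> cyclic_code n g" for c
  proof -
    have "c \<bullet> trace_word a = (\<Sum>i=0..<n. c $ i * trace_bit (\<Sum>j=1..e. a j * \<theta> ^ (i * (2 * j - 1))))"
      by (simp add: scalar_prod_def trace_word_def)
    also have "\<dots> = trace_bit (\<Sum>i=0..<n. of_bit (c $ i) * (\<Sum>j=1..e. a j * \<theta> ^ (i * (2 * j - 1))))"
      by (simp only: trace_bit_of_bit_mult trace_bit_sum)
    also have "(\<Sum>i=0..<n. of_bit (c $ i) * (\<Sum>j=1..e. a j * \<theta> ^ (i * (2 * j - 1))))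
        = (\<Sum>j=1..e. a j * (\<Sum>i=0..<n. of_bit (c $ i) * \<theta> ^ (i * (2 * j - 1))))"
      unfolding sum_distrib_left by (subst sum.swap) (simp only: mult.left_commute)
    also have "\<dots> = 0"
      by (intro sum.neutral ballI) (simp only: eval_bit_codeword[OF c] mult_zero_right)
    finally show ?thesis by simp
  qed
  then show ?thesis by (simp add: \<O>_def dual_code_def trace_word_def)
qed

end

section \<open>Consequences of (P1) and (P2): conjugates, distinct trace words, size of the
  dual\<close>

locale bch_params = bch K m n e \<theta> for K :: "'k::{field,finite} itself" and m n e \<theta> +
  assumes P1: "\<And>j m1. j \<in> {1..e} \<Longrightarrow> 0 < m1 \<Longrightarrow> m1 dvd m \<Longrightarrow> m1 < m \<Longrightarrow>
      \<not> n dvd (2 * j - 1) * (2 ^ m1 - 1)"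
    and P2: "2 ^ (m * e) < (\<Sum>i = 0..e + 1. n choose i)"
begin

text \<open>Otherwise component j' of a syndrome would be determined by component j, and the sets of
  at most e points would inject into e - 1 field elements. Multiplying that bound by 2^m contradicts
  (P2).\<close>

lemma theta_pow_odd_not_conjugate:
  assumes j: "j \<in> {1..e}" "j' \<in> {1..e}" "j \<noteq> j'"
  shows "\<theta> ^ (2 * j' - 1) \<noteq> (\<theta> ^ (2 * j - 1)) ^ 2 ^ s"
proof
  assume eq: "\<theta> ^ (2 * j' - 1) = (\<theta> ^ (2 * j - 1)) ^ 2 ^ s"
  define J where "J = {1..e} - {j'}"
  define S where "S U = restrict (syndrome U) J" for U :: "'k set"
  have conj: "power_sum U (2 * j' - 1) = power_sum U (2 * j - 1) ^ 2 ^ s" if "0 \<notin> U" for U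
    unfolding power_sum_def frob_sum
  proof (intro sum.cong refl)
    fix x assume "x \<in> U"
    then have "x \<in> (\<lambda>i. \<theta> ^ i) ` {..<n}" using that by (auto simp: theta_pow_image)
    then obtain i where "x = \<theta> ^ i" by blast
    then show "x ^ (2 * j' - 1) = (x ^ (2 * j - 1)) ^ 2 ^ s"
    proof -
      have sw: "(z ^ k) ^ l = (z ^ l) ^ k" for z :: 'k and k l
        by (simp add: mult.commute flip: power_mult)
      have "x ^ (2 * j' - 1) = ((\<theta> ^ (2 * j - 1)) ^ 2 ^ s) ^ i"
        unfolding \<open>x = \<theta> ^ i\<close> sw[of \<theta> i] eq ..
      also have "\<dots> = (x ^ (2 * j - 1)) ^ 2 ^ s"
        unfolding \<open>x = \<theta> ^ i\<close> sw[of \<theta> i] by (rule sw)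
      finally show ?thesis .
    qed
  qed
  have "inj_on S (small_sets e)"
  proof (rule inj_onI)
    fix U V assume UV: "U \<in> small_sets e" "V \<in> small_sets e" "S U = S V"
    have J: "power_sum U (2 * i - 1) = power_sum V (2 * i - 1)" if "i \<in> J" for i
      using fun_cong[OF UV(3), of i] that by (simp add: S_def J_def syndrome_def)
    have "0 \<notin> U" "0 \<notin> V" using UV by (auto simp: small_sets_def)
    then have "power_sum U (2 * j' - 1) = power_sum V (2 * j' - 1)"
      using J[of j] j conj by (metis DiffI J_def empty_iff insert_iff)
    then have "power_sum U (2 * i - 1) = power_sum V (2 * i - 1)" if "i \<in> {1..e}" for i
      using J[of i] that by (cases "i = j'") (auto simp: J_def)
    then have "syndrome U = syndrome V"
      by (auto simp: syndrome_def fun_eq_iff)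
    then show "U = V" using inj_on_syndrome UV by (auto dest: inj_onD)
  qed
  then have "card (small_sets e) \<le> card (J \<rightarrow>\<^sub>E (UNIV :: 'k set))"
    by (rule card_inj_on_le) (auto simp: S_def J_def intro!: finite_PiE split: if_splits)
  also have "\<dots> = 2 ^ (m * (e - 1))"
    using j by (simp add: card_PiE J_def card_field power_mult)
  finally have le: "(\<Sum>i=0..e. n choose i) \<le> 2 ^ (m * (e - 1))"
    by (simp only: card_small_sets)
  have "2 ^ (m * e) < Suc n * (\<Sum>i=0..e. n choose i)"
    using P2 sum_choose_Suc_le[of n e] by (simp only: Suc_eq_plus1)
  also have "\<dots> \<le> Suc n * 2 ^ (m * (e - 1))"
    using le by (rule mult_le_mono2)
  also have "Suc n = 2 ^ m" by (simp add: n_def)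
  also have "2 ^ m * 2 ^ (m * (e - 1)) = (2::nat) ^ (m * e)"
    using e by (cases e) (simp_all add: power_add)
  finally show False by simp
qed

text \<open>The element would lie in the subfield belonging to d = gcd t m, a proper divisor of m,
  and its power 2^d - 1 would be 1, which (P1) excludes.\<close>

lemma theta_pow_odd_full_orbit:
  assumes j: "j \<in> {1..e}" and t: "0 < t" "t < m"
  shows "\<theta> ^ (2 * j - 1) \<notin> frob_fix t"
proof
  assume "\<theta> ^ (2 * j - 1) \<in> frob_fix t"
  then have "\<theta> ^ (2 * j - 1) \<in> frob_fix (gcd t m)"
    by (rule frob_fix_gcd) simp
  define d where "d = gcd t m"
  have d: "0 < d" "d dvd m" "d \<le> t" using t by (auto simp: d_def intro: gcd_le1_nat)
  have "\<theta> ^ ((2 * j - 1) * 2 ^ d) = \<theta> ^ (2 * j - 1)"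
    using \<open>\<theta> ^ (2 * j - 1) \<in> frob_fix (gcd t m)\<close> by (simp add: frob_fix_def d_def power_mult)
  moreover have "(2 * j - 1) * 2 ^ d = (2 * j - 1) + (2 * j - 1) * (2 ^ d - 1)"
    by (simp add: diff_mult_distrib2)
  ultimately have "\<theta> ^ ((2 * j - 1) * (2 ^ d - 1)) = 1"
    using theta_ne_0 by (simp add: power_add)
  then show False
    using P1[OF j d(1,2)] d(3) t(2) by (simp add: theta_pow_eq_1_iff)
qed

lemma inj_on_conjugates:
  "inj_on (\<lambda>(j, l). (\<theta> ^ (2 * j - 1)) ^ 2 ^ l) ({1..e} \<times> {..<m})"
proof (rule inj_onI)
  fix u v assume uv: "u \<in> {1..e} \<times> {..<m}" "v \<in> {1..e} \<times> {..<m}"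
    "(case u of (j, l) \<Rightarrow> (\<theta> ^ (2 * j - 1)) ^ 2 ^ l) = (case v of (j, l) \<Rightarrow> (\<theta> ^ (2 * j - 1)) ^ 2 ^ l)"
  obtain j l j' l' where jl: "u = (j, l)" "v = (j', l')" by (cases u; cases v)
  then have eq: "(\<theta> ^ (2 * j - 1)) ^ 2 ^ l = (\<theta> ^ (2 * j' - 1)) ^ 2 ^ l'"
    and mem: "j \<in> {1..e}" "j' \<in> {1..e}" "l < m" "l' < m"
    using uv by auto
  have "j = j'"
  proof (rule ccontr)
    assume "j \<noteq> j'"
    have "\<theta> ^ (2 * j' - 1) = ((\<theta> ^ (2 * j' - 1)) ^ 2 ^ l') ^ 2 ^ (m - l')"
    proof -
      have "(2::nat) ^ l' * 2 ^ (m - l') = 2 ^ m" using mem by (simp flip: power_add)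
      then show ?thesis by (metis power_mult frob_m)
    qed
    also have "\<dots> = (\<theta> ^ (2 * j - 1)) ^ 2 ^ (l + (m - l'))"
      unfolding eq[symmetric] by (simp only: power_mult power_add)
    finally show False
      using theta_pow_odd_not_conjugate[OF mem(1,2) \<open>j \<noteq> j'\<close>] by blast
  qed
  have *: False if "a < b" "b < m" "(\<theta> ^ (2 * j - 1)) ^ 2 ^ a = (\<theta> ^ (2 * j - 1)) ^ 2 ^ b" for a b
  proof -
    have "(\<theta> ^ (2 * j - 1)) ^ 2 ^ b = ((\<theta> ^ (2 * j - 1)) ^ 2 ^ (b - a)) ^ 2 ^ a"
    proof -
      have "(2::nat) ^ (b - a) * 2 ^ a = 2 ^ b" using that(1) by (simp flip: power_add)
      then show ?thesis by (metis power_mult)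
    qed
    then have "\<theta> ^ (2 * j - 1) = (\<theta> ^ (2 * j - 1)) ^ 2 ^ (b - a)"
      using that(3) frob_inj by metis
    then have "\<theta> ^ (2 * j - 1) \<in> frob_fix (b - a)"
      by (simp add: frob_fix_def)
    then show False
      using theta_pow_odd_full_orbit[OF mem(1), of "b - a"] that by (metis less_imp_diff_less zero_less_diff)
  qed
  have "l = l'"
    using *[of l l'] *[of l' l] eq mem \<open>j = j'\<close> by (cases l l' rule: linorder_cases) auto
  then show "u = v" using jl \<open>j = j'\<close> by simp
qed

text \<open>Written out, the trace is an exponential sum in i with the m*e conjugates as nodes and
  the weights (a j)^(2^l). The nodes are distinct and nonzero, so there are at most n of them and
  the n equations suffice. The weight for l = 0 is a j itself.\<close>

lemma trace_sum_eq_0_imp: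
  assumes zero: "\<And>i. i < n \<Longrightarrow> tr m (\<Sum>j=1..e. a j * \<theta> ^ (i * (2 * j - 1))) = 0" and j: "j \<in> {1..e}"
  shows "a j = 0"
proof -
  define \<beta> where "\<beta> = (\<lambda>(j, l). (\<theta> ^ (2 * j - 1)) ^ 2 ^ l)"
  define w where "w = (\<lambda>(j, l). (a j) ^ 2 ^ l)"
  define S where "S = {1..e} \<times> {..<m}"
  have inj: "inj_on \<beta> S"
    unfolding \<beta>_def S_def by (rule inj_on_conjugates)
  have "card S \<le> card (UNIV - {0::'k})"
    by (rule card_inj_on_le[OF inj]) (auto simp: \<beta>_def theta_ne_0)
  then have cardS: "card S \<le> n"
    by (simp add: card_Diff_singleton card_field n_def)
  have "(\<Sum>s\<in>S. w s * \<beta> s ^ i) = 0" if "i < card S" for i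
  proof -
    have term_eq: "w (j, l) * \<beta> (j, l) ^ i = (a j * \<theta> ^ (i * (2 * j - 1))) ^ 2 ^ l" for j l
    proof -
      have "(2 * j - 1) * 2 ^ l * i = i * (2 * j - 1) * 2 ^ l" by (simp only: mult_ac)
      then have "((\<theta> ^ (2 * j - 1)) ^ 2 ^ l) ^ i = (\<theta> ^ (i * (2 * j - 1))) ^ 2 ^ l"
        by (simp only: power_mult[symmetric])
      then show ?thesis
        by (simp only: w_def \<beta>_def prod.case power_mult_distrib)
    qed
    have "(\<Sum>s\<in>S. w s * \<beta> s ^ i) = (\<Sum>j=1..e. \<Sum>l<m. (a j * \<theta> ^ (i * (2 * j - 1))) ^ 2 ^ l)"
      unfolding S_def sum.cartesian_product
      by (intro sum.cong refl) (auto simp only: term_eq)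
    also have "\<dots> = tr m (\<Sum>j=1..e. a j * \<theta> ^ (i * (2 * j - 1)))"
      unfolding tr_sum by (simp only: tr_def)
    also have "\<dots> = 0" using that cardS by (intro zero) simp
    finally show ?thesis .
  qed
  moreover have "finite S" "(j, 0) \<in> S"
    using j m by (simp_all add: S_def)
  ultimately have "w (j, 0) = 0"
    using exp_sum_coeffs_eq_0[OF _ inj] by blast
  then show ?thesis by (simp add: w_def)
qed

definition params :: "(nat \<Rightarrow> 'k) set" where
  "params = {1..e} \<rightarrow>\<^sub>E UNIV"

lemma card_params: "finite params" "card params = 2 ^ (m * e)"
  by (auto simp: params_def card_PiE card_field power_mult intro: finite_PiE)

lemma inj_on_trace_word: "inj_on trace_word params"
proof (rule inj_onI)
  fix a b assume ab: "a \<in> params" "b \<in> params" "trace_word a = trace_word b"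
  have "a j + b j = 0" if "j \<in> {1..e}" for j
    using that
  proof (rule trace_sum_eq_0_imp[rotated])
    fix i assume "i < n"
    then have "trace_word a $ i = trace_word b $ i" using ab by simp
    then have "trace_bit (\<Sum>j=1..e. a j * \<theta> ^ (i * (2 * j - 1))) = trace_bit (\<Sum>j=1..e. b j * \<theta> ^ (i * (2 * j - 1)))"
      using \<open>i < n\<close> by (simp add: trace_word_def)
    then have "trace_bit ((\<Sum>j=1..e. a j * \<theta> ^ (i * (2 * j - 1))) + (\<Sum>j=1..e. b j * \<theta> ^ (i * (2 * j - 1)))) = 0"
      by (simp only: trace_bit_add) (simp add: trace_bit_def)
    then show "tr m (\<Sum>j=1..e. (a j + b j) * \<theta> ^ (i * (2 * j - 1))) = 0"
      by (simp add: trace_bit_def distrib_right sum.distrib split: if_splits)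
  qed
  then have "a j = b j" if "j \<in> {1..e}" for j
    using that add_eq_zero_iff by blast
  then show "a = b"
    using ab unfolding params_def by (intro PiE_ext[of a "{1..e}" "\<lambda>_. UNIV" b]) auto
qed

lemma dual_eq_trace_words: "\<O> = trace_word ` params"
  and card_dual: "card \<O> = 2 ^ (m * e)"
proof -
  have sub: "trace_word ` params \<subseteq> \<O>"
    using trace_word_in_dual by blast
  have "card \<O> \<le> 2 ^ (m * e)"
    using card_dual_le power_increasing[OF degree_g_le, of "2::nat"] by linarith
  then have "card \<O> \<le> card (trace_word ` params)"
    by (simp add: card_image[OF inj_on_trace_word] card_params)
  then show "\<O> = trace_word ` params"
    using card_seteq[OF finite_dual sub] by simp
  then show "card \<O> = 2 ^ (m * e)"
    by (simp add: card_image[OF inj_on_trace_word] card_params)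
qed

lemma sum_choose_le: "(\<Sum>i=0..r. n choose i) \<le> 2 ^ n"
proof -
  have "card (small_sets r) \<le> card (Pow (UNIV - {0::'k}))"
    by (intro card_mono) (auto simp: small_sets_def)
  then show ?thesis
    by (simp add: card_small_sets card_Pow card_Diff_singleton card_field n_def)
qed

text \<open>(P2) against the total number 2^n of subsets gives m*e < n, and m = 1 would mean n = 1.
  An array of strength 2*e needs that many columns.\<close>

lemma two_e_less: "2 * e < n"
proof -
  have "(2::nat) ^ (m * e) < 2 ^ n"
    using P2 sum_choose_le[of "e + 1"] by linarith
  then have lt: "m * e < n" by simp
  have "m \<noteq> 1"
  proof
    assume "m = 1"
    then show False using lt e by (simp add: n_def)
  qed
  then have "2 \<le> m" using m by simp
  then have "2 * e \<le> m * e" by (rule mult_le_mono1)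
  then show ?thesis using lt by linarith
qed

lemma sum_trace_word:
  assumes "W \<subseteq> {0..<n}"
  shows "(\<Sum>i\<in>W. trace_word a $ i) = trace_bit (\<Sum>j=1..e. a j * power_sum ((\<lambda>i. \<theta> ^ i) ` W) (2 * j - 1))"
proof -
  have inj: "inj_on (\<lambda>i. \<theta> ^ i) W"
    using theta_pow_inj assms by (rule inj_on_subset[OF _ order.trans]) auto
  have "(\<Sum>i\<in>W. trace_word a $ i) = (\<Sum>i\<in>W. trace_bit (\<Sum>j=1..e. a j * \<theta> ^ (i * (2 * j - 1))))"
    using assms by (intro sum.cong) (auto simp: trace_word_def)
  also have "\<dots> = trace_bit (\<Sum>i\<in>W. \<Sum>j=1..e. a j * \<theta> ^ (i * (2 * j - 1)))"
    by (simp only: trace_bit_sum)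
  also have "(\<Sum>i\<in>W. \<Sum>j=1..e. a j * \<theta> ^ (i * (2 * j - 1))) = (\<Sum>j=1..e. a j * (\<Sum>i\<in>W. \<theta> ^ (i * (2 * j - 1))))"
    unfolding sum_distrib_left by (rule sum.swap)
  also have "\<dots> = (\<Sum>j=1..e. a j * power_sum ((\<lambda>i. \<theta> ^ i) ` W) (2 * j - 1))"
    unfolding power_sum_def by (subst sum.reindex[OF inj]) (simp add: power_mult)
  finally show ?thesis .
qed

end
subsection \<open>Strength\<close>

text \<open>Fourier expansion: the indicator of the pattern is the product over T of (1 + \<chi>(c_i
  + a_i)) / 2, which expands into one character for each W in T. A word of C with odd sum on W, used
  as a translation, makes the sum of that character over C vanish unless W is empty.\<close>

lemma card_codewords_with_pattern:
  fixes C :: "bit vec set"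
  assumes fin: "finite C" "finite T" and carrier: "C \<subseteq> carrier_vec n" and T: "T \<subseteq> {0..<n}"
    and add: "\<And>c c'. c \<in> C \<Longrightarrow> c' \<in> C \<Longrightarrow> c + c' \<in> C"
    and odd: "\<And>W. W \<subseteq> T \<Longrightarrow> W \<noteq> {} \<Longrightarrow> \<exists>c\<in>C. (\<Sum>i\<in>W. c $ i) = 1"
  shows "card {c \<in> C. \<forall>i\<in>T. c $ i = a i} * 2 ^ card T = card C"
proof -
  define \<chi> where "\<chi> b = (if b = 0 then 1 else - 1 :: int)" for b :: bit
  have chi_add: "\<chi> (x + y) = \<chi> x * \<chi> y" for x y
    by (cases x; cases y) (auto simp: \<chi>_def)
  have chi_sum: "(\<Prod>i\<in>W. \<chi> (f i)) = \<chi> (\<Sum>i\<in>W. f i)" for W and f :: "nat \<Rightarrow> bit"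
  proof (induction W rule: infinite_finite_induct)
    case (insert x F)
    then show ?case by (metis (no_types, lifting) chi_add sum.insert prod.insert)
  qed (simp_all add: \<chi>_def)
  have vanish: "(\<Sum>c\<in>C. \<Prod>i\<in>W. \<chi> (c $ i)) = 0" if W: "W \<subseteq> T" "W \<noteq> {}" for W
  proof -
    obtain d where d: "d \<in> C" "(\<Sum>i\<in>W. d $ i) = 1" using odd[OF W] by blast
    have dim: "dim_vec c = n" if "c \<in> C" for c using carrier that by auto
    have dd: "c + d + d = c" if "c \<in> C" for c
    proof (rule eq_vecI)
      fix i assume "i < dim_vec c"
      then show "(c + d + d) $ i = c $ i"
        using dim[OF that] dim[OF d(1)] by (cases "d $ i"; cases "c $ i") auto
    qed (use dim that d in auto)
    have "(\<Sum>c\<in>C. \<Prod>i\<in>W. \<chi> (c $ i)) = (\<Sum>c\<in>C. \<Prod>i\<in>W. \<chi> ((c + d) $ i))"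
      by (rule sum.reindex_bij_witness[of _ "\<lambda>c. c + d" "\<lambda>c. c + d"]) (simp_all add: add d(1) dd)
    also have "\<dots> = (\<Sum>c\<in>C. - (\<Prod>i\<in>W. \<chi> (c $ i)))"
    proof (intro sum.cong refl)
      fix c assume c: "c \<in> C"
      have "(\<Prod>i\<in>W. \<chi> ((c + d) $ i)) = (\<Prod>i\<in>W. \<chi> (c $ i) * \<chi> (d $ i))"
      proof (intro prod.cong refl)
        fix i assume "i \<in> W"
        then have "i < n" using W(1) T by auto
        then have "(c + d) $ i = c $ i + d $ i" using dim[OF d(1)] by simp
        then show "\<chi> ((c + d) $ i) = \<chi> (c $ i) * \<chi> (d $ i)" by (simp only: chi_add)
      qed
      also have "\<dots> = (\<Prod>i\<in>W. \<chi> (c $ i)) * \<chi> (\<Sum>i\<in>W. d $ i)"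
        by (simp only: prod.distrib chi_sum)
      finally show "(\<Prod>i\<in>W. \<chi> ((c + d) $ i)) = - (\<Prod>i\<in>W. \<chi> (c $ i))"
        by (simp add: d(2)) (simp add: \<chi>_def)
    qed
    finally show ?thesis by (simp add: sum_negf)
  qed
  have match: "(\<Prod>i\<in>T. \<chi> (c $ i + a i) + 1) = (if \<forall>i\<in>T. c $ i = a i then 2 ^ card T else 0)" for c :: "bit vec"
  proof (cases "\<forall>i\<in>T. c $ i = a i")
    case True
    have "x + x = 0" for x :: bit by (cases x) auto
    then have "(\<Prod>i\<in>T. \<chi> (c $ i + a i) + 1) = (\<Prod>i\<in>T. 2)"
      using True by (intro prod.cong) (auto simp: \<chi>_def)
    then show ?thesis using True by simp
  next
    case False
    then obtain i where i: "i \<in> T" "c $ i \<noteq> a i" by blast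
    have "x \<noteq> y \<Longrightarrow> x + y = 1" for x y :: bit by (cases x; cases y) auto
    from this[OF i(2)] have "\<chi> (c $ i + a i) + 1 = 0" by (simp add: \<chi>_def)
    then have "\<exists>i\<in>T. \<chi> (c $ i + a i) + 1 = 0" using i(1) by blast
    then have "(\<Prod>i\<in>T. \<chi> (c $ i + a i) + 1) = 0" by (rule prod_zero[OF fin(2)])
    then show ?thesis using False by auto
  qed
  have "int (card {c \<in> C. \<forall>i\<in>T. c $ i = a i} * 2 ^ card T) = (\<Sum>c\<in>C. \<Prod>i\<in>T. \<chi> (c $ i + a i) + 1)"
    unfolding match sum.inter_filter[OF fin(1), symmetric] by simp
  also have "\<dots> = (\<Sum>c\<in>C. \<Sum>W\<in>Pow T. (\<Prod>i\<in>W. \<chi> (a i)) * (\<Prod>i\<in>W. \<chi> (c $ i)))"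
    by (simp only: prod_add[OF fin(2)] chi_add prod.distrib prod.neutral_const mult_1_right mult_1_left mult.commute)
  also have "\<dots> = (\<Sum>W\<in>Pow T. (\<Prod>i\<in>W. \<chi> (a i)) * (\<Sum>c\<in>C. \<Prod>i\<in>W. \<chi> (c $ i)))"
    by (subst sum.swap) (simp only: sum_distrib_left)
  also have "\<dots> = (\<Sum>W\<in>Pow T. if W = {} then int (card C) else 0)"
    using vanish by (intro sum.cong refl) auto
  also have "\<dots> = int (card C)"
    using fin(2) by simp
  finally show ?thesis by (simp only: of_nat_eq_iff)
qed

context bch_params
begin

lemma dual_add:
  assumes "v \<in> \<O>" "w \<in> \<O>" shows "v + w \<in> \<O>"
proof -
  have "c \<in> carrier_vec n" if "c \<in> cyclic_code n g" for c
    using that by (auto simp: cyclic_code_def)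
  then show ?thesis
    using assms by (auto simp: \<O>_def dual_code_def scalar_prod_add_distrib[of _ n])
qed

lemma ex_odd_codeword:
  assumes W: "W \<subseteq> {0..<n}" "W \<noteq> {}" "card W \<le> 2 * e"
  shows "\<exists>c\<in>\<O>. (\<Sum>i\<in>W. c $ i) = 1"
proof -
  define U where "U = (\<lambda>i. \<theta> ^ i) ` W"
  have "card U \<le> 2 * e"
    using W(3) card_image_le[of W "\<lambda>i. \<theta> ^ i"] finite_subset[OF W(1)] by (simp add: U_def)
  moreover have "0 \<notin> U" "U \<noteq> {}" using W by (auto simp: U_def theta_ne_0)
  ultimately obtain j where j: "j \<in> {1..e}" "power_sum U (2 * j - 1) \<noteq> 0"
    using bch_bound by blast
  obtain z where z: "tr m z \<noteq> 0"
    using ex_tr_ne_zero[OF m, of UNIV] card_field by auto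
  define a where "a = (\<lambda>i. if i = j then z / power_sum U (2 * j - 1) else 0)"
  have "(\<Sum>i=1..e. a i * power_sum U (2 * i - 1)) = (\<Sum>i=1..e. if i = j then z else 0)"
    using j(2) by (intro sum.cong) (auto simp: a_def)
  also have "\<dots> = z" using j(1) by simp
  finally have "(\<Sum>i\<in>W. trace_word a $ i) = 1"
    unfolding sum_trace_word[OF W(1)] U_def[symmetric] using z by (simp add: trace_bit_def)
  then show ?thesis using trace_word_in_dual by blast
qed

lemma orthogonal_array_dual: "orthogonal_array n (2 * e) \<O>"
proof -
  have "real (card {c \<in> \<O>. \<forall>i\<in>T. c $ i = a i}) = real (card \<O>) / 2 ^ (2 * e)"
    if T: "T \<subseteq> {0..<n}" "card T = 2 * e" for T a
  proof -
    have finT: "finite T" using T(1) finite_subset by blast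
    have "card {c \<in> \<O>. \<forall>i\<in>T. c $ i = a i} * 2 ^ card T = card \<O>"
    proof (rule card_codewords_with_pattern[OF finite_dual finT _ T(1) dual_add])
      fix W assume "W \<subseteq> T" "W \<noteq> {}"
      then show "\<exists>c\<in>\<O>. (\<Sum>i\<in>W. c $ i) = 1"
        using T card_mono[OF finT, of W] by (intro ex_odd_codeword) auto
    qed (auto simp: \<O>_def dual_code_def)
    from arg_cong[OF this, of real] show ?thesis
      by (simp add: T(2) field_simps)
  qed
  then show ?thesis
    using two_e_less by (auto simp: orthogonal_array_def \<O>_def dual_code_def)
qed

lemma ex_dependent_set:
  "\<exists>U. 0 \<notin> U \<and> U \<noteq> {} \<and> card U \<le> 2 * e + 1 \<and> (\<forall>j\<in>{1..e}. power_sum U (2 * j - 1) = 0)"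
proof -
  have "syndrome ` small_sets (e + 1) \<subseteq> params"
    by (auto simp: syndrome_def params_def)
  from card_inj_on_le[OF _ this card_params(1)]
  have "\<not> inj_on syndrome (small_sets (e + 1))"
    using P2 unfolding card_small_sets card_params(2) not_le[symmetric] by blast
  then obtain U V where UV: "U \<in> small_sets (e + 1)" "V \<in> small_sets (e + 1)" "U \<noteq> V" "syndrome U = syndrome V"
    by (auto simp: inj_on_def)
  define Z where "Z = (U - V) \<union> (V - U)"
  have "card Z \<le> card (U - V) + card (V - U)" unfolding Z_def by (rule card_Un_le)
  also have "\<dots> \<le> card U + card V" by (intro add_mono card_mono) auto
  also have "\<dots> \<le> 2 * e + 2" using UV by (auto simp: small_sets_def)
  finally have cardZ: "card Z \<le> 2 * e + 2" .
  have Z: "Z \<noteq> {}" "0 \<notin> Z" using UV by (auto simp: Z_def small_sets_def)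
  have zero: "power_sum Z (2 * j - 1) = 0" if "j \<in> {1..e}" for j
  proof -
    have "power_sum Z (2 * j - 1) = power_sum U (2 * j - 1) + power_sum V (2 * j - 1)"
      unfolding power_sum_def Z_def by (rule sum_symmetric_difference) auto
    also have "power_sum U (2 * j - 1) = power_sum V (2 * j - 1)"
      using fun_cong[OF UV(4), of j] that by (simp add: syndrome_def)
    finally show ?thesis by simp
  qed
  show ?thesis
  proof (cases "card Z \<le> 2 * e + 1")
    case True
    then show ?thesis using Z zero by (intro exI[of _ Z]) blast
  next
    case False
    then have card: "card Z = 2 * e + 2" using cardZ by simp
    text \<open>The extended code is invariant under translations, so a point of \<open>Z\<close> can be moved to 0 and dropped.\<close>
    have zero': "power_sum Z l = 0" if "l \<le> 2 * e" for l
    proof (cases "l = 0")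
      case True
      then show ?thesis by (simp add: power_sum_def card two_eq_zero)
    next
      case False
      then show ?thesis using power_sum_eq_0_all[OF zero] that by simp
    qed
    obtain z where z: "z \<in> Z" using Z by blast
    define Y' where "Y' = (\<lambda>x. x + z) ` (Z - {z})"
    have inj: "inj_on (\<lambda>x. x + z) (Z - {z})" by (rule inj_onI) simp
    have cardY: "card Y' = 2 * e + 1"
      unfolding Y'_def card_image[OF inj] using card z by (simp add: card_Diff_singleton)
    have "power_sum Y' (2 * j - 1) = 0" if j: "j \<in> {1..e}" for j
    proof -
      define k where "k = 2 * j - 1"
      have k: "0 < k" "k \<le> 2 * e" using j by (auto simp: k_def)
      have "power_sum Y' k = (\<Sum>x\<in>Z - {z}. (x + z) ^ k)"
        unfolding power_sum_def Y'_def by (subst sum.reindex[OF inj]) simp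
      also have "\<dots> = (\<Sum>x\<in>Z. (x + z) ^ k)"
        using k(1) z by (subst (2) sum.remove[of _ z]) (auto simp: power_0_left)
      also have "\<dots> = (\<Sum>x\<in>Z. \<Sum>l\<le>k. of_nat (k choose l) * x ^ l * z ^ (k - l))"
        by (simp only: binomial_ring)
      also have "\<dots> = (\<Sum>l\<le>k. of_nat (k choose l) * power_sum Z l * z ^ (k - l))"
        by (subst sum.swap) (simp add: power_sum_def sum_distrib_left sum_distrib_right)
      also have "\<dots> = 0" using zero' k(2) by simp
      finally show ?thesis by (simp add: k_def)
    qed
    moreover have "0 \<notin> Y'" by (auto simp: Y'_def add_eq_zero_iff)
    moreover have "Y' \<noteq> {}" using cardY by auto
    ultimately show ?thesis using cardY by (intro exI[of _ Y']) simp
  qed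
qed

text \<open>On the coordinates W of a dependent set every word of \<O> has even sum, so a pattern
  with a single 1 on W never occurs. As W has at most 2*e + 1 points it extends to \<tau> columns,
  where the array property would demand a positive number of occurrences.\<close>

lemma not_orthogonal_array_dual:
  assumes "\<tau> > 2 * e" shows "\<not> orthogonal_array n \<tau> \<O>"
proof
  assume OA: "orthogonal_array n \<tau> \<O>"
  obtain U where U: "0 \<notin> U" "U \<noteq> {}" "card U \<le> 2 * e + 1" "\<And>j. j \<in> {1..e} \<Longrightarrow> power_sum U (2 * j - 1) = 0"
    using ex_dependent_set by blast
  define W where "W = {i \<in> {0..<n}. \<theta> ^ i \<in> U}"
  have img: "(\<lambda>i. \<theta> ^ i) ` W = U"
  proof -
    have "x \<in> (\<lambda>i. \<theta> ^ i) ` {..<n}" if "x \<in> U" for x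
      using that U(1) by (auto simp: theta_pow_image)
    then show ?thesis by (fastforce simp: W_def)
  qed
  have W: "W \<subseteq> {0..<n}" "finite W" "W \<noteq> {}" using img U(2) by (auto simp: W_def)
  have "inj_on (\<lambda>i. \<theta> ^ i) W"
    using theta_pow_inj W(1) by (rule inj_on_subset[OF _ order.trans]) auto
  then have "card W \<le> \<tau>" using U(3) assms img card_image by fastforce
  moreover have "\<tau> \<le> n" using OA by (simp add: orthogonal_array_def)
  ultimately obtain T where T: "W \<subseteq> T" "T \<subseteq> {0..<n}" "card T = \<tau>"
    using exists_subset_between[of W \<tau> "{0..<n}"] W(1) by auto
  obtain i0 where i0: "i0 \<in> W" using W(3) by blast
  define a where "a i = (if i = i0 then 1 else 0 :: bit)" for i :: nat
  have empty: "{c \<in> \<O>. \<forall>i\<in>T. c $ i = a i} = {}"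
  proof safe
    fix c assume c: "c \<in> \<O>" "\<forall>i\<in>T. c $ i = a i"
    obtain b where b: "c = trace_word b" using c(1) unfolding dual_eq_trace_words by blast
    have "(\<Sum>i\<in>W. c $ i) = (\<Sum>i\<in>W. if i = i0 then 1 else 0)"
      using c(2) T(1) by (intro sum.cong) (auto simp: a_def)
    also have "\<dots> = 1" using i0 W(2) by simp
    finally have "(\<Sum>i\<in>W. c $ i) = 1" .
    moreover have "(\<Sum>i\<in>W. c $ i) = 0"
    proof -
      have "(\<Sum>j=1..e. b j * power_sum U (2 * j - 1)) = 0"
        by (intro sum.neutral ballI) (simp only: U(4) mult_zero_right)
      then show ?thesis
        unfolding b sum_trace_word[OF W(1)] img by (simp only: trace_bit_0)
    qed
    ultimately show "c \<in> {}" by simp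
  qed
  have "real (card {c \<in> \<O>. \<forall>i\<in>T. c $ i = a i}) = real (card \<O>) / 2 ^ \<tau>"
    using OA T unfolding orthogonal_array_def by blast
  then show False unfolding empty card_dual by simp
qed

lemma strength_dual: "strength n \<O> = 2 * e"
  unfolding strength_def
proof (rule Max_eqI)
  show "finite {\<tau>. orthogonal_array n \<tau> \<O>}"
    by (rule finite_subset[of _ "{..n}"]) (auto simp: orthogonal_array_def)
  show "\<tau> \<le> 2 * e" if "\<tau> \<in> {\<tau>. orthogonal_array n \<tau> \<O>}" for \<tau>
    using that not_orthogonal_array_dual[of \<tau>] by (cases "\<tau> \<le> 2 * e") auto
qed (simp add: orthogonal_array_dual)

end

subsection \<open>Covering radius\<close>

lemma covering_radius_ge:
  assumes "finite C" "C \<noteq> {}" "y \<in> carrier_vec n" and r: "\<And>x. x \<in> C \<Longrightarrow> r \<le> real (hamming_dist x y)"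
  shows "r \<le> real (covering_radius n C)"
proof -
  have "(carrier_vec n :: bit vec set) \<subseteq> vec n ` ({..<n} \<rightarrow>\<^sub>E UNIV)"
  proof
    fix v :: "bit vec" assume "v \<in> carrier_vec n"
    then show "v \<in> vec n ` ({..<n} \<rightarrow>\<^sub>E UNIV)"
      by (intro image_eqI[of _ _ "\<lambda>i\<in>{..<n}. v $ i"]) auto
  qed
  then have fin: "finite (carrier_vec n :: bit vec set)"
    by (rule finite_subset) (intro finite_imageI finite_PiE, simp_all add: card_UNIV_bit)
  have "Min ((\<lambda>x. hamming_dist x y) ` C) \<in> (\<lambda>x. hamming_dist x y) ` C"
    using assms(1,2) by (intro Min_in) auto
  then have "r \<le> real (Min ((\<lambda>x. hamming_dist x y) ` C))"
    using r by (metis (no_types, lifting) imageE)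
  also have "\<dots> \<le> real (covering_radius n C)"
    unfolding covering_radius_def using fin assms(3) by (intro of_nat_mono Max_ge) auto
  finally show ?thesis .
qed

context bch_params
begin

text \<open>The point x = 0 always has trace 0 but is no coordinate, hence the -1 in the bound.
  Twice the number of x with trace 0 is 2^m + s, and f has only odd exponents up to 2*e - 1, so the
  Weil bound for s, halved, leaves e - 1.\<close>

lemma hamming_dist_trace_word_ones:
  "2 ^ (m - 1) - 1 - (real e - 1) * 2 powr (real m / 2)
     \<le> real (hamming_dist (trace_word a) (vec n (\<lambda>_. 1)))"
proof -
  define f where "f = (\<Sum>j=1..e. monom (a j) (2 * j - 1))"
  have poly_f: "poly f x = (\<Sum>j=1..e. a j * x ^ (2 * j - 1))" for x
    by (simp add: f_def poly_sum poly_monom)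
  define S where "S = {x. tr m (poly f x) = 0}"
  define s where "s = (\<Sum>x\<in>UNIV. psi m (poly f x))"
  have "s = (\<Sum>x\<in>UNIV. (if x \<in> S then 2 else 0) - 1)"
    unfolding s_def by (intro sum.cong) (auto simp: psi_def S_def)
  also have "\<dots> = 2 * int (card S) - 2 ^ m"
    by (simp add: sum_subtractf sum.If_cases card_field)
  finally have s: "s = 2 * int (card S) - 2 ^ m" .
  have zeroS: "0 \<in> S"
    unfolding S_def poly_f by (auto simp: power_0_left intro!: sum.neutral)
  have eval: "(\<Sum>j=1..e. a j * \<theta> ^ (i * (2 * j - 1))) = poly f (\<theta> ^ i)" for i
    unfolding poly_f by (simp only: power_mult)
  have "hamming_dist (trace_word a) (vec n (\<lambda>_. 1)) = card {i \<in> {..<n}. \<theta> ^ i \<in> S}"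
    unfolding hamming_dist_def
    by (intro arg_cong[of _ _ card]) (auto simp: trace_word_def eval trace_bit_def S_def simp del: One_nat_def split: if_splits)
  also have "\<dots> = card ((\<lambda>i. \<theta> ^ i) ` {i \<in> {..<n}. \<theta> ^ i \<in> S})"
    by (intro card_image[symmetric] inj_on_subset[OF theta_pow_inj]) auto
  also have "(\<lambda>i. \<theta> ^ i) ` {i \<in> {..<n}. \<theta> ^ i \<in> S} = S - {0}"
  proof -
    have "x \<in> (\<lambda>i. \<theta> ^ i) ` {..<n}" if "x \<noteq> 0" for x
      using that by (auto simp: theta_pow_image)
    then show ?thesis by (fastforce simp: theta_ne_0)
  qed
  also have "card (S - {0}) = card S - 1"
    using zeroS by (simp add: card_Diff_singleton)
  finally have "hamming_dist (trace_word a) (vec n (\<lambda>_. 1)) = card S - 1" .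
  moreover have "card S \<ge> 1"
    using zeroS by (simp add: Suc_le_eq card_gt_0_iff) auto
  ultimately have dist: "real (hamming_dist (trace_word a) (vec n (\<lambda>_. 1))) = (2 ^ m + real_of_int s) / 2 - 1"
    by (simp add: s of_nat_diff)
  have sqrt: "sqrt (2 ^ m) = 2 powr (real m / 2)"
    by (simp add: powr_half_sqrt[symmetric] powr_powr flip: powr_realpow)
  have "real_of_int s \<ge> - ((2 * real e - 2) * sqrt (2 ^ m))"
  \<comment> \<open>The zero polynomial has even degree 0 and escapes the Weil bound; there s is
    2^m.\<close>
  proof (cases "f = 0")
    case True
    then have "s = 2 ^ m" by (simp add: s_def card_field)
    moreover have "0 \<le> (2 * real e - 2) * sqrt (2 ^ m)" using e by simp
    ultimately show ?thesis by (simp only: of_int_power of_int_numeral) (smt (verit) zero_le_power)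
  next
    case False
    have coeff_f: "coeff f i = (\<Sum>j=1..e. coeff (monom (a j) (2 * j - 1)) i)" for i
      by (simp only: f_def coeff_sum)
    have "(\<Sum>j=1..e. coeff (monom (a j) (2 * j - 1)) (degree f)) \<noteq> 0"
      using False unfolding coeff_f[symmetric] leading_coeff_0_iff .
    then obtain j where j: "j \<in> {1..e}" "coeff (monom (a j) (2 * j - 1)) (degree f) \<noteq> 0"
      by (meson sum.neutral)
    then have deg: "degree f = 2 * j - 1"
      by (auto split: if_splits)
    then have "odd (degree f)" using j(1) by (simp add: even_diff_nat)
    then have "\<bar>real_of_int s\<bar> \<le> (real (degree f) - 1) * sqrt (2 ^ m)"
      unfolding s_def by (rule weil_bound_finite_field[OF card_field m])
    also have "\<dots> \<le> (2 * real e - 2) * sqrt (2 ^ m)"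
      using deg j(1) by (intro mult_right_mono) (auto simp: of_nat_diff)
    finally show ?thesis by linarith
  qed
  moreover have "(2::real) ^ m = 2 * 2 ^ (m - 1)"
    using m by (cases m) auto
  ultimately show ?thesis
    unfolding dist sqrt by (simp add: algebra_simps)
qed

lemma covering_radius_dual:
  "2 ^ (m - 1) - 1 - (real e - 1) * 2 powr (real m / 2) \<le> real (covering_radius n \<O>)"
proof (rule covering_radius_ge[OF finite_dual])
  show "\<O> \<noteq> {}" using trace_word_in_dual by blast
  show "2 ^ (m - 1) - 1 - (real e - 1) * 2 powr (real m / 2) \<le> real (hamming_dist x (vec n (\<lambda>_. 1)))"
    if "x \<in> \<O>" for x
    using that hamming_dist_trace_word_ones unfolding dual_eq_trace_words by blast
qed simp

end

theorem theorem6p3: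
  fixes e m n :: nat
    and \<theta> :: "'a::{field,finite}"
    and g :: "bit poly"
    and \<C> \<O> :: "bit vec set"
  assumes "e > 0" and "m > 0"
    and P1: "\<forall>j\<in>{1..e}. \<not> (\<exists>m\<^sub>1::nat. m\<^sub>1 > 0 \<and> m\<^sub>1 dvd m \<and> m\<^sub>1 < m \<and>
               2 ^ m - 1 dvd (2 * j - 1) * (2 ^ m\<^sub>1 - 1))"
    and P2: "(\<Sum>i = 0..e + 1. (2 ^ m - 1) choose i) > 2 ^ (m * e)"
    and n_def: "n = 2 ^ m - 1"
    and field_card: "CARD('a) = 2 ^ m"
    and \<theta>: "primitive_element \<theta>"
    and g_def: "g = (\<Prod>j = 1..e. minimal_poly (\<theta> ^ (2 * j - 1)))"
    and \<C>_def: "\<C> = cyclic_code n g"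
    and \<O>_def: "\<O> = dual_code n \<C>"
  shows "orthogonal_array n (2 * e) \<O> \<and>
         card \<O> = 2 ^ (m * e) \<and>
         strength n \<O> = 2 * e \<and>
         real (covering_radius n \<O>) \<ge> 2 ^ (m - 1) - 1 - (real e - 1) * 2 powr (real m / 2)"
proof -
  interpret B: bch_params "TYPE('a)" m n e \<theta>
    using assms CHAR_eq_2_of_CARD[OF field_card] unfolding n_def by unfold_locales blast+
  have "\<O> = B.\<O>"
    by (simp only: \<O>_def \<C>_def g_def B.\<O>_def B.g_def)
  then show ?thesis
    using B.orthogonal_array_dual B.card_dual B.strength_dual B.covering_radius_dual by simp
qed
end
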